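(* Let $f:\hat{\mathbb{C}}\to\hat{\mathbb{C}}$ be a bicritical rational map and let $\phi\in\mathrm{Deck}(f^k)$ for some $k\ge 1$. Then $\phi(\mathcal{C}_f)=\mathcal{C}_f$.
   Context: $\hat{\mathbb{C}}$ is the Riemann sphere and $f^k$ is the $k$-th iterate of $f$. For a rational map $f$, $\mathcal{C}_f$ is its set of critical points in $\hat{\mathbb{C}}$. $f$ is bicritical if $|\mathcal{C}_f|=2$. The deck group of a rational map $F$ is $\mathrm{Deck}(F)=\{\mu \text{ a Möbius transformation of } \hat{\mathbb{C}} : F\circ\mu=F\}$. *)

theory Defs
  imports "HOL-Analysis.Analysis" "HOL-Computational_Algebra.Polynomial"
begin

text \<open>
  The Riemann sphere is the one-point compactification of the complex plane, with \<open>None\<close> as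
  the point at infinity (as in \<^const>\<open>Alexandroff_compactification\<close>).
\<close>

type_synonym riemann_sphere = "complex option"

text \<open>The point \<open>[a : b]\<close> of the projective line; it is only meaningful if \<open>(a, b) \<noteq> (0, 0)\<close>.\<close>

definition hom_point :: "complex \<Rightarrow> complex \<Rightarrow> riemann_sphere" where
  "hom_point a b = (if b = 0 then None else Some (a / b))"

text \<open>
  For coprime \<open>p\<close> and \<open>q\<close>, the self-map of the sphere induced by \<open>p / q\<close>. The value at infinity
  is read off the homogenisations of \<open>p\<close> and \<open>q\<close> of degree \<open>max (degree p) (degree q)\<close>.
\<close>

definition rat_fun :: "complex poly \<Rightarrow> complex poly \<Rightarrow> riemann_sphere \<Rightarrow> riemann_sphere" where
  "rat_fun p q x =
     (case x of
        Some z \<Rightarrow> hom_point (poly p z) (poly q z)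
      | None \<Rightarrow> (let n = max (degree p) (degree q) in hom_point (coeff p n) (coeff q n)))"

definition rational_map :: "(riemann_sphere \<Rightarrow> riemann_sphere) \<Rightarrow> bool" where
  "rational_map f \<longleftrightarrow> (\<exists>p q. coprime p q \<and> f = rat_fun p q)"

definition moebius :: "complex \<Rightarrow> complex \<Rightarrow> complex \<Rightarrow> complex \<Rightarrow> riemann_sphere \<Rightarrow> riemann_sphere" where
  "moebius a b c d x =
     (case x of
        Some z \<Rightarrow> hom_point (a * z + b) (c * z + d)
      | None \<Rightarrow> hom_point a c)"

definition moebius_transformation :: "(riemann_sphere \<Rightarrow> riemann_sphere) \<Rightarrow> bool" where
  "moebius_transformation \<mu> \<longleftrightarrow> (\<exists>a b c d. a * d - b * c \<noteq> 0 \<and> \<mu> = moebius a b c d)"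

text \<open>
  The complex structure is given by the two standard coordinates, \<open>z\<close> around finite points and
  \<open>1 / z\<close> around infinity. \<open>chart x\<close> is the one used around \<open>x\<close>, and \<open>chart_inv x\<close> is its inverse.
  The values of \<open>chart (Some _)\<close> at infinity and of \<open>chart None\<close> at \<open>0\<close>, which lie outside the
  respective coordinate domains, are irrelevant.
\<close>

definition chart :: "riemann_sphere \<Rightarrow> riemann_sphere \<Rightarrow> complex" where
  "chart x y =
     (case y of
        Some z \<Rightarrow> (if x = None then 1 / z else z)
      | None \<Rightarrow> 0)"

definition chart_inv :: "riemann_sphere \<Rightarrow> complex \<Rightarrow> riemann_sphere" where
  "chart_inv x t = (if x = None then hom_point 1 t else Some t)"

text \<open>The points at which the derivative of \<open>f\<close> in local coordinates vanishes.\<close>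

definition critical_points :: "(riemann_sphere \<Rightarrow> riemann_sphere) \<Rightarrow> riemann_sphere set" where
  "critical_points f =
     {x. ((chart (f x) \<circ> f \<circ> chart_inv x) has_field_derivative 0) (at (chart x x))}"

definition bicritical :: "(riemann_sphere \<Rightarrow> riemann_sphere) \<Rightarrow> bool" where
  "bicritical f \<longleftrightarrow> card (critical_points f) = 2"

definition Deck :: "(riemann_sphere \<Rightarrow> riemann_sphere) \<Rightarrow> (riemann_sphere \<Rightarrow> riemann_sphere) set" where
  "Deck F = {\<mu>. moebius_transformation \<mu> \<and> F \<circ> \<mu> = F}"

end

theory Submission
  imports Defs "HOL-Algebra.Sylow" "HOL-Algebra.Group_Action" "HOL-Algebra.Multiplicative_Group"
    "HOL-Computational_Algebra.Fundamental_Theorem_Algebra"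
begin

text \<open>
  By Riemann-Hurwitz, a bicritical map of degree \<open>d\<close> is \<open>M \<circ> z ^ d \<circ> B\<close> with Moebius
  transformations \<open>M\<close> and \<open>B\<close> (\<open>bicritical_normal_form\<close>). After conjugation by \<open>B\<close>, the map is
  \<open>f = M \<circ> z ^ d\<close> and its critical set is \<open>C = {0, \<infinity>}\<close>. A point \<open>x\<close> then has local degree
  \<open>d ^ hits K x\<close> under \<open>f ^^ K\<close>, where \<open>hits K x\<close> counts the visits to \<open>C\<close> among the first \<open>K\<close> points
  of the orbit of \<open>x\<close>. Deck transformations of \<open>f ^^ K\<close> preserve \<open>f ^^ K\<close>, hence also \<open>hits K\<close>.

  Let \<open>G\<close> be the deck group of \<open>f ^^ K\<close>, where \<open>K \<ge> 2\<close> without loss of generality since the deck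
  groups increase with \<open>K\<close>. It is finite, as a Moebius transformation is
  determined by its values at three points of a fibre, and it acts freely on a generic fibre; so its
  order and the lengths of its orbits divide \<open>d ^ K\<close>. It contains the
  rotations by the \<open>d\<close>-th roots of unity, which act freely outside \<open>C\<close>. If \<open>\<infinity>\<close> is not in the orbit of
  \<open>0\<close>, both orbits have length \<open>1\<close> modulo \<open>d\<close>, hence length \<open>1\<close>, and \<open>G\<close> fixes \<open>0\<close> and
  \<open>\<infinity>\<close>. Otherwise the common orbit \<open>P\<close> has length \<open>2\<close> modulo \<open>d\<close>. Either its length is \<open>2\<close>, so that
  \<open>P = C\<close> is invariant, or arithmetic forces \<open>4\<close> to divide the length and \<open>d\<close> to be \<open>2\<close>
  modulo \<open>4\<close>.

  The last case is impossible, for a dynamical and a group theoretic reason. The points \<open>0\<close>,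
  \<open>\<infinity>\<close> and some \<open>x \<in> P - C\<close> have the same value under \<open>f ^^ K\<close> and the same number of hits, although
  \<open>x\<close> hits \<open>C\<close> for the first time later than the points of \<open>C\<close> do. This makes the critical
  orbits end in a cycle that avoids \<open>C\<close>, and the equality of the counts then implies that a critical
  orbit never returns to \<open>C\<close> (\<open>critical_orbits_disjoint\<close>). Thus \<open>hits K \<le> 1\<close>
  everywhere, and if an element of \<open>G\<close> fixes a point, its derivative there is a \<open>d\<close>-th root of unity.
  On the other hand, \<open>8\<close> divides the order of \<open>G\<close>, since the stabiliser of \<open>0\<close> contains the \<open>d\<close>
  rotations. By Sylow's theorem \<open>G\<close> has a subgroup of order \<open>8\<close>. Its derivatives at fixed points are
  both \<open>d\<close>-th and \<open>8\<close>-th roots of unity, hence \<open>\<plusminus>1\<close>, so it consists of commuting involutions;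
  but a group of commuting involutions on the sphere has at most four elements
  (\<open>no_moebius_group_of_order_8\<close>).
\<close>

section \<open>Moebius transformations\<close>

lemma hom_point_scale: "k \<noteq> 0 \<Longrightarrow> hom_point (k * a) (k * b) = hom_point a b"
  by (simp add: hom_point_def)

text \<open>
  Homogeneous coordinates avoid case distinctions at infinity in most computations below.
\<close>

lemma hom_point_cases:
  obtains a b where "x = hom_point a b" "a \<noteq> 0 \<or> b \<noteq> 0"
proof (cases x)
  case None
  then show ?thesis using that[of 1 0] by (simp add: hom_point_def)
next
  case (Some z)
  then show ?thesis using that[of z 1] by (simp add: hom_point_def)
qed

lemma moebius_hom_point:
  assumes "x \<noteq> 0 \<or> y \<noteq> 0"
  shows "moebius a b c d (hom_point x y) = hom_point (a * x + b * y) (c * x + d * y)"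
proof (cases "y = 0")
  case True
  then show ?thesis
    using assms hom_point_scale[of x a c] by (simp add: hom_point_def[of x] moebius_def mult.commute)
next
  case False
  have "hom_point (y * (a * (x / y) + b)) (y * (c * (x / y) + d))
      = hom_point (a * (x / y) + b) (c * (x / y) + d)"
    by (rule hom_point_scale[OF False])
  then show ?thesis
    using False by (simp add: hom_point_def[of x] moebius_def algebra_simps)
qed

lemma nonsingular_nonzero:
  fixes a b c d :: complex
  assumes "a * d - b * c \<noteq> 0" "x \<noteq> 0 \<or> y \<noteq> 0"
  shows "a * x + b * y \<noteq> 0 \<or> c * x + d * y \<noteq> 0"
proof (rule ccontr)
  assume "\<not> ?thesis"
  then have e: "a * x + b * y = 0" "c * x + d * y = 0" by auto
  have "(a * d - b * c) * x = d * (a * x + b * y) - b * (c * x + d * y)"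
       "(a * d - b * c) * y = a * (c * x + d * y) - c * (a * x + b * y)"
    by (simp_all add: algebra_simps)
  with e assms show False by auto
qed

lemma moebius_comp:
  assumes "a' * d' - b' * c' \<noteq> 0"
  shows "moebius a b c d \<circ> moebius a' b' c' d' =
         moebius (a * a' + b * c') (a * b' + b * d') (c * a' + d * c') (c * b' + d * d')"
proof
  fix x
  obtain u v where x: "x = hom_point u v" "u \<noteq> 0 \<or> v \<noteq> 0" by (rule hom_point_cases)
  then show "(moebius a b c d \<circ> moebius a' b' c' d') x =
      moebius (a * a' + b * c') (a * b' + b * d') (c * a' + d * c') (c * b' + d * d') x"
    using nonsingular_nonzero[OF assms x(2)]
    by (simp add: moebius_hom_point) (simp add: algebra_simps)
qed

lemma moebius_diagonal: "k \<noteq> 0 \<Longrightarrow> moebius k 0 0 k = id"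
  by (rule ext) (simp add: moebius_def hom_point_def split: option.split)

lemma moebius_transformation_id: "moebius_transformation id"
  unfolding moebius_transformation_def
  by (rule exI[of _ 1], rule exI[of _ 0], rule exI[of _ 0], rule exI[of _ 1])
     (simp add: moebius_diagonal)

lemma moebius_transformation_comp:
  assumes "moebius_transformation \<mu>" "moebius_transformation \<nu>"
  shows "moebius_transformation (\<mu> \<circ> \<nu>)"
proof -
  obtain a b c d a' b' c' d' where
    "a * d - b * c \<noteq> 0" "\<mu> = moebius a b c d" "a' * d' - b' * c' \<noteq> 0" "\<nu> = moebius a' b' c' d'"
    using assms unfolding moebius_transformation_def by blast
  moreover have "(a * a' + b * c') * (c * b' + d * d') - (a * b' + b * d') * (c * a' + d * c') =
    (a * d - b * c) * (a' * d' - b' * c')"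
    by (simp add: algebra_simps)
  ultimately show ?thesis
    unfolding moebius_transformation_def
    by (metis moebius_comp no_zero_divisors)
qed

lemma moebius_transformation_inverse:
  assumes "moebius_transformation \<mu>"
  obtains \<nu> where "moebius_transformation \<nu>" "\<nu> \<circ> \<mu> = id" "\<mu> \<circ> \<nu> = id"
proof -
  obtain a b c d where m: "a * d - b * c \<noteq> 0" "\<mu> = moebius a b c d"
    using assms unfolding moebius_transformation_def by blast
  have m': "d * a - (-b) * (-c) \<noteq> 0" using m by (simp add: algebra_simps)
  show ?thesis
  proof (rule that)
    show "moebius_transformation (moebius d (-b) (-c) a)"
      using m' unfolding moebius_transformation_def by blast
    have k: "d * a - b * c \<noteq> 0" "a * d - b * c \<noteq> 0" "- (c * b) + d * a \<noteq> 0" "- (b * c) + a * d \<noteq> 0"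
      using m by (simp_all add: algebra_simps)
    show "moebius d (-b) (-c) a \<circ> \<mu> = id"
      unfolding m(2) moebius_comp[OF m(1)]
      using moebius_diagonal[OF m(1)] by (simp add: algebra_simps)
    show "\<mu> \<circ> moebius d (-b) (-c) a = id"
      unfolding m(2) moebius_comp[OF m']
      using moebius_diagonal[OF m(1)] by (simp add: algebra_simps)
  qed
qed

lemma moebius_transformation_bij: "moebius_transformation \<mu> \<Longrightarrow> bij \<mu>"
  by (metis moebius_transformation_inverse o_bij)

lemma moebius_transformation_scale: "k \<noteq> 0 \<Longrightarrow> moebius_transformation (moebius k 0 0 1)"
  unfolding moebius_transformation_def by (metis mult.right_neutral mult_zero_left diff_zero)

lemma moebius_transformation_inversion: "moebius_transformation (moebius 0 1 1 0)"
  unfolding moebius_transformation_def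
  by (rule exI[of _ 0], rule exI[of _ 1], rule exI[of _ 1], rule exI[of _ 0]) simp

lemma moebius_transformation_shift: "moebius_transformation (moebius 1 b 0 1)"
  unfolding moebius_transformation_def
  by (rule exI[of _ 1], rule exI[of _ b], rule exI[of _ 0], rule exI[of _ 1]) simp

lemma moebius_transformation_to_zero:
  obtains \<alpha> where "moebius_transformation \<alpha>" "\<alpha> (Some 0) = x"
proof (cases x)
  case None
  then show ?thesis using that[OF moebius_transformation_inversion]
    by (simp add: moebius_def hom_point_def)
next
  case (Some z)
  then show ?thesis using that[OF moebius_transformation_shift[of z]]
    by (simp add: moebius_def hom_point_def)
qed

lemma moebius_fixes_Some:
  assumes "a * d - b * c \<noteq> 0"
  shows "moebius a b c d (Some z) = Some z \<longleftrightarrow> poly [:-b, d - a, c:] z = 0"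
proof (cases "c * z + d = 0")
  case True
  then have "a * z + b \<noteq> 0" using nonsingular_nonzero[OF assms, of z 1] by simp
  moreover have "poly [:-b, d - a, c:] z = z * (c * z + d) - (a * z + b)"
    by (simp add: algebra_simps)
  ultimately have "poly [:-b, d - a, c:] z \<noteq> 0" using True by (metis diff_zero eq_neg_iff_add_eq_0 minus_diff_eq mult_zero_right)
  then show ?thesis using True by (simp add: moebius_def hom_point_def)
next
  case False
  have "moebius a b c d (Some z) = Some z \<longleftrightarrow> a * z + b = z * (c * z + d)"
    using False by (simp add: moebius_def hom_point_def divide_eq_eq)
  also have "\<dots> \<longleftrightarrow> poly [:-b, d - a, c:] z = 0" by (auto simp: algebra_simps)
  finally show ?thesis .
qed

lemma moebius_fixes_None: "moebius a b c d None = None \<longleftrightarrow> c = 0"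
  by (simp add: moebius_def hom_point_def)

lemma moebius_transformation_fixed_point:
  assumes "moebius_transformation \<mu>"
  obtains x where "\<mu> x = x"
proof -
  obtain a b c d where m: "a * d - b * c \<noteq> 0" "\<mu> = moebius a b c d"
    using assms unfolding moebius_transformation_def by blast
  show ?thesis
  proof (cases "c = 0")
    case True
    then show ?thesis using that[of None] m by (simp add: moebius_fixes_None)
  next
    case False
    then have "\<not> constant (poly [:-b, d - a, c:])" by (simp add: constant_degree)
    then obtain z where "poly [:-b, d - a, c:] z = 0"
      using fundamental_theorem_of_algebra by blast
    then show ?thesis using that[of "Some z"] m moebius_fixes_Some[OF m(1)] by simp
  qed
qed

text \<open>
  The fixed points are the roots of a quadratic polynomial, with infinity as an
  additional one when the leading coefficient vanishes and the degree drops accordingly.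
\<close>

lemma moebius_transformation_fixed_points:
  assumes "moebius_transformation \<mu>" "\<mu> \<noteq> id"
  shows "finite {x. \<mu> x = x}" "card {x. \<mu> x = x} \<le> 2"
proof -
  obtain a b c d where m: "a * d - b * c \<noteq> 0" "\<mu> = moebius a b c d"
    using assms unfolding moebius_transformation_def by blast
  let ?r = "[:-b, d - a, c:]"
  have "?r \<noteq> 0"
  proof
    assume "?r = 0"
    then have e: "b = 0" "c = 0" "d = a" by simp_all
    then have "a \<noteq> 0" using m by auto
    then have "\<mu> = id" using m e by (simp add: moebius_diagonal)
    then show False using assms by simp
  qed
  then have fin: "finite {z. poly ?r z = 0}" and card: "card {z. poly ?r z = 0} \<le> degree ?r"
    by (rule poly_roots_finite, rule card_poly_roots_bound) 
  have sub: "{x. \<mu> x = x} \<subseteq> Some ` {z. poly ?r z = 0} \<union> (if c = 0 then {None} else {})" (is "_ \<subseteq> ?S")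
  proof
    fix x assume x: "x \<in> {x. \<mu> x = x}"
    show "x \<in> ?S"
    proof (cases x)
      case None
      then have "c = 0" using x m moebius_fixes_None by simp
      then show ?thesis using None by simp
    next
      case (Some z)
      then have "poly ?r z = 0" using x m moebius_fixes_Some[OF m(1), of z] by simp
      then show ?thesis using Some by blast
    qed
  qed
  show "finite {x. \<mu> x = x}" by (rule finite_subset[OF sub]) (use fin in simp)
  have "card {x. \<mu> x = x} \<le> card ?S" by (rule card_mono[OF _ sub]) (use fin in simp)
  also have "\<dots> \<le> card (Some ` {z. poly ?r z = 0}) + card (if c = 0 then {None :: riemann_sphere} else {})"
    by (rule card_Un_le)
  also have "card (Some ` {z. poly ?r z = 0}) = card {z. poly ?r z = 0}"
    by (rule card_image) simp
  also have "card {z. poly ?r z = 0} + card (if c = 0 then {None :: riemann_sphere} else {}) \<le> 2"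
  proof (cases "c = 0")
    case True
    then have "degree ?r \<le> 1" by simp
    then have "card {z. poly ?r z = 0} \<le> 1" using card by linarith
    then show ?thesis using True by simp
  next
    case False
    then have "degree ?r = 2" by simp
    then have "card {z. poly ?r z = 0} \<le> 2" using card by linarith
    then show ?thesis using False by simp
  qed
  finally show "card {x. \<mu> x = x} \<le> 2" by simp
qed

section \<open>Local degrees\<close>

text \<open>
  In the coordinate around \<open>0\<close>, \<open>L\<close> fixes \<open>0\<close> and behaves like \<open>c t ^ n\<close> to leading order. The
  function \<open>s\<close> is only constrained on a punctured neighbourhood, where \<open>L\<close> has to be finite.
\<close>

definition leading_term :: "(riemann_sphere \<Rightarrow> riemann_sphere) \<Rightarrow> nat \<Rightarrow> complex \<Rightarrow> bool" where
  "leading_term L n c \<longleftrightarrow> n \<ge> 1 \<and> c \<noteq> 0 \<and> L (Some 0) = Some 0 \<and>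
     (\<exists>s. (\<forall>\<^sub>F t in at 0. L (Some t) = Some (s t)) \<and> ((\<lambda>t. s t / t ^ n) \<longlongrightarrow> c) (at 0))"

text \<open>
  Arbitrary Moebius transformations serve as coordinates \<open>\<alpha>\<close> around \<open>x\<close> and \<open>\<beta>\<close> around \<open>F x\<close>:
  since \<open>L\<close> fixes \<open>0\<close>, the equation \<open>F \<circ> \<alpha> = \<beta> \<circ> L\<close> entails \<open>\<beta> 0 = F x\<close>.
\<close>

definition has_local_degree :: "(riemann_sphere \<Rightarrow> riemann_sphere) \<Rightarrow> riemann_sphere \<Rightarrow> nat \<Rightarrow> bool" where
  "has_local_degree F x n \<longleftrightarrow> (\<exists>\<alpha> \<beta> L c. moebius_transformation \<alpha> \<and> moebius_transformation \<beta> \<and>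
     \<alpha> (Some 0) = x \<and> F \<circ> \<alpha> = \<beta> \<circ> L \<and> leading_term L n c)"

lemma leading_term_unique:
  assumes "leading_term L n c" "leading_term L m c'"
  shows "n = m" "c = c'"
proof -
  have *: False if lt: "leading_term L n c" "leading_term L m c'" and "n < m" for n m c c'
  proof -
    obtain s where s: "\<forall>\<^sub>F t in at 0. L (Some t) = Some (s t)" "((\<lambda>t. s t / t ^ n) \<longlongrightarrow> c) (at 0)"
      using lt(1) unfolding leading_term_def by blast
    obtain s' where s': "\<forall>\<^sub>F t in at 0. L (Some t) = Some (s' t)" "((\<lambda>t. s' t / t ^ m) \<longlongrightarrow> c') (at 0)"
      using lt(2) unfolding leading_term_def by blast
    have "((\<lambda>t. s' t / t ^ m * t ^ (m - n)) \<longlongrightarrow> c' * 0 ^ (m - n)) (at 0)"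
      by (intro tendsto_intros s')
    moreover have "\<forall>\<^sub>F t in at 0. s' t / t ^ m * t ^ (m - n) = s t / t ^ n"
      using s(1) s'(1) eventually_neq_at_within[of 0 0]
    proof eventually_elim
      case (elim t)
      then show ?case using \<open>n < m\<close> by (simp add: power_diff)
    qed
    ultimately have "((\<lambda>t. s t / t ^ n) \<longlongrightarrow> c' * 0 ^ (m - n)) (at 0)"
      by (rule Lim_transform_eventually)
    then have "c = c' * 0 ^ (m - n)" using s(2) tendsto_unique[OF trivial_limit_at] by blast
    then show False using lt \<open>n < m\<close> by (simp add: leading_term_def)
  qed
  show nm: "n = m" using *[OF assms] *[OF assms(2,1)] by (meson linorder_neqE_nat)
  obtain s where s: "\<forall>\<^sub>F t in at 0. L (Some t) = Some (s t)" "((\<lambda>t. s t / t ^ n) \<longlongrightarrow> c) (at 0)"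
    using assms(1) unfolding leading_term_def by blast
  obtain s' where s': "\<forall>\<^sub>F t in at 0. L (Some t) = Some (s' t)" "((\<lambda>t. s' t / t ^ n) \<longlongrightarrow> c') (at 0)"
    using assms(2) nm unfolding leading_term_def by blast
  have "\<forall>\<^sub>F t in at 0. s' t / t ^ n = s t / t ^ n"
    using s(1) s'(1) by eventually_elim simp
  with s'(2) have "((\<lambda>t. s t / t ^ n) \<longlongrightarrow> c') (at 0)"
    by (rule Lim_transform_eventually)
  then show "c = c'" using s(2) tendsto_unique[OF trivial_limit_at] by blast
qed

lemma leading_term_comp:
  assumes "leading_term L n c" "leading_term K m c'"
  shows "leading_term (K \<circ> L) (n * m) (c' * c ^ m)"
proof -
  obtain s where s: "\<forall>\<^sub>F t in at 0. L (Some t) = Some (s t)" "((\<lambda>t. s t / t ^ n) \<longlongrightarrow> c) (at 0)"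
    and L: "n \<ge> 1" "c \<noteq> 0" "L (Some 0) = Some 0"
    using assms(1) unfolding leading_term_def by blast
  obtain r where r: "\<forall>\<^sub>F t in at 0. K (Some t) = Some (r t)" "((\<lambda>t. r t / t ^ m) \<longlongrightarrow> c') (at 0)"
    and K: "m \<ge> 1" "c' \<noteq> 0" "K (Some 0) = Some 0"
    using assms(2) unfolding leading_term_def by blast
  have nz: "\<forall>\<^sub>F t in at 0. s t \<noteq> 0"
    using tendsto_imp_eventually_ne[OF s(2) L(2)] by eventually_elim auto
  have "((\<lambda>t. s t / t ^ n * t ^ n) \<longlongrightarrow> c * 0 ^ n) (at 0)"
    by (intro tendsto_intros s)
  moreover have "\<forall>\<^sub>F t in at 0. s t / t ^ n * t ^ n = s t"
    using eventually_neq_at_within[of 0 0] by eventually_elim simp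
  ultimately have "(s \<longlongrightarrow> c * 0 ^ n) (at 0)" by (rule Lim_transform_eventually)
  then have lim: "filterlim s (at 0) (at 0)"
    using L nz by (simp add: filterlim_at power_0_left)
  have ev: "\<forall>\<^sub>F t in at 0. (K \<circ> L) (Some t) = Some (r (s t))"
    using s(1) eventually_compose_filterlim[OF r(1) lim] by eventually_elim simp
  have "((\<lambda>t. r (s t) / s t ^ m * (s t / t ^ n) ^ m) \<longlongrightarrow> c' * c ^ m) (at 0)"
    by (intro tendsto_intros s filterlim_compose[OF r(2) lim])
  \<comment> \<open>This uses that \<open>s\<close> is eventually nonzero, which holds because \<open>c \<noteq> 0\<close>.\<close>
  moreover have "\<forall>\<^sub>F t in at 0. r (s t) / s t ^ m * (s t / t ^ n) ^ m = r (s t) / t ^ (n * m)"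
    using nz by eventually_elim (simp add: power_divide power_mult)
  ultimately have "((\<lambda>t. r (s t) / t ^ (n * m)) \<longlongrightarrow> c' * c ^ m) (at 0)"
    by (rule Lim_transform_eventually)
  then show ?thesis
    unfolding leading_term_def using ev K L by (auto intro!: exI[of _ "\<lambda>t. r (s t)"])
qed

lemma leading_term_moebius:
  assumes "d \<noteq> 0" "a \<noteq> 0"
  shows "leading_term (moebius a 0 c d) 1 (a / d)"
proof -
  have lim: "((\<lambda>t. c * t + d) \<longlongrightarrow> c * 0 + d) (at 0)" by (intro tendsto_intros)
  then have "\<forall>\<^sub>F t in at 0. c * t + d \<noteq> 0"
    using assms by (intro tendsto_imp_eventually_ne) auto
  then have 1: "\<forall>\<^sub>F t in at 0. moebius a 0 c d (Some t) = Some (a * t / (c * t + d))"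
    by eventually_elim (simp add: moebius_def hom_point_def)
  have "((\<lambda>t. a / (c * t + d)) \<longlongrightarrow> a / (c * 0 + d)) (at 0)"
    using assms by (intro tendsto_intros) auto
  moreover have "\<forall>\<^sub>F t in at 0. a / (c * t + d) = a * t / (c * t + d) / t ^ 1"
    using eventually_neq_at_within[of 0 0] by eventually_elim simp
  ultimately have "((\<lambda>t. a * t / (c * t + d) / t ^ 1) \<longlongrightarrow> a / (c * 0 + d)) (at 0)"
    by (rule Lim_transform_eventually)
  then show ?thesis unfolding leading_term_def
    using 1 assms by (intro conjI exI[of _ "\<lambda>t. a * t / (c * t + d)"]) (simp_all add: moebius_def hom_point_def)
qed

lemma leading_term_moebius_transformation:
  assumes "moebius_transformation h" "h (Some 0) = Some 0"
  obtains l where "leading_term h 1 l"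
proof -
  obtain a b c d where m: "a * d - b * c \<noteq> 0" "h = moebius a b c d"
    using assms unfolding moebius_transformation_def by blast
  have "d \<noteq> 0" "b = 0" using assms(2) unfolding m(2)
    by (auto simp: moebius_def hom_point_def split: if_splits)
  moreover from this have "a \<noteq> 0" using m by auto
  ultimately show ?thesis using that leading_term_moebius m by blast
qed

lemma leading_term_id: "leading_term id 1 1"
  using leading_term_moebius[of 1 1 0] by (simp add: moebius_diagonal)

text \<open>
  Two choices of coordinates differ by Moebius transformations that fix \<open>0\<close>; these have local degree
  \<open>1\<close>, and leading exponents are multiplicative under composition.
\<close>

lemma has_local_degree_unique:
  assumes "has_local_degree F x n" "has_local_degree F x m"
  shows "n = m"
proof -
  obtain \<alpha> \<beta> L c where 1: "moebius_transformation \<alpha>" "moebius_transformation \<beta>"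
     "\<alpha> (Some 0) = x" "F \<circ> \<alpha> = \<beta> \<circ> L" "leading_term L n c"
    using assms unfolding has_local_degree_def by blast
  obtain \<alpha>' \<beta>' L' c' where 2: "moebius_transformation \<alpha>'" "moebius_transformation \<beta>'"
     "\<alpha>' (Some 0) = x" "F \<circ> \<alpha>' = \<beta>' \<circ> L'" "leading_term L' m c'"
    using assms unfolding has_local_degree_def by blast
  obtain \<alpha>i where ai: "moebius_transformation \<alpha>i" "\<alpha>i \<circ> \<alpha> = id" "\<alpha> \<circ> \<alpha>i = id"
    using moebius_transformation_inverse[OF 1(1)] .
  obtain \<beta>i where bi: "moebius_transformation \<beta>i" "\<beta>i \<circ> \<beta>' = id" "\<beta>' \<circ> \<beta>i = id"
    using moebius_transformation_inverse[OF 2(2)] .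
  have L0: "L (Some 0) = Some 0" "L' (Some 0) = Some 0" using 1 2 by (auto simp: leading_term_def)
  have "(\<alpha>i \<circ> \<alpha>') (Some 0) = Some 0"
    using 1(3) 2(3) ai(2) by (metis comp_apply id_apply)
  then obtain l where l: "leading_term (\<alpha>i \<circ> \<alpha>') 1 l"
    using leading_term_moebius_transformation moebius_transformation_comp[OF ai(1) 2(1)] by blast
  have "\<beta> (Some 0) = \<beta>' (Some 0)" using 1(3,4) 2(3,4) L0 by (metis comp_apply)
  then have "(\<beta>i \<circ> \<beta>) (Some 0) = Some 0"
    using bi(2) by (metis comp_apply id_apply)
  then obtain k where k: "leading_term (\<beta>i \<circ> \<beta>) 1 k"
    using leading_term_moebius_transformation moebius_transformation_comp[OF bi(1) 1(2)] by blast
  have "L' = (\<beta>i \<circ> \<beta>') \<circ> L'" using bi by simp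
  also have "\<dots> = \<beta>i \<circ> (F \<circ> \<alpha>')" using 2 by (simp add: comp_assoc)
  also have "\<dots> = \<beta>i \<circ> (F \<circ> (\<alpha> \<circ> \<alpha>i) \<circ> \<alpha>')" using ai by simp
  also have "\<dots> = \<beta>i \<circ> ((F \<circ> \<alpha>) \<circ> (\<alpha>i \<circ> \<alpha>'))" by (simp add: comp_assoc)
  also have "\<dots> = (\<beta>i \<circ> \<beta>) \<circ> (L \<circ> (\<alpha>i \<circ> \<alpha>'))" unfolding 1(4) by (simp add: comp_assoc)
  finally have "leading_term L' (1 * n * 1) (k * (c * l ^ n) ^ 1)"
    using leading_term_comp[OF leading_term_comp[OF l 1(5)] k] by simp
  from leading_term_unique(1)[OF this 2(5)] show ?thesis by simp
qed

lemma has_local_degree_comp: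
  assumes "has_local_degree F x n" "has_local_degree G (F x) m"
  shows "has_local_degree (G \<circ> F) x (n * m)"
proof -
  obtain \<alpha> \<beta> L c where 1: "moebius_transformation \<alpha>" "moebius_transformation \<beta>"
     "\<alpha> (Some 0) = x" "F \<circ> \<alpha> = \<beta> \<circ> L" "leading_term L n c"
    using assms unfolding has_local_degree_def by blast
  obtain \<alpha>' \<beta>' L' c' where 2: "moebius_transformation \<alpha>'" "moebius_transformation \<beta>'"
     "\<alpha>' (Some 0) = F x" "G \<circ> \<alpha>' = \<beta>' \<circ> L'" "leading_term L' m c'"
    using assms unfolding has_local_degree_def by blast
  obtain \<alpha>i where ai: "moebius_transformation \<alpha>i" "\<alpha>i \<circ> \<alpha>' = id" "\<alpha>' \<circ> \<alpha>i = id"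
    using moebius_transformation_inverse[OF 2(1)] .
  have L0: "L (Some 0) = Some 0" using 1 by (auto simp: leading_term_def)
  have "\<beta> (Some 0) = \<alpha>' (Some 0)" using 1(3,4) 2(3) L0 by (metis comp_apply)
  then have "(\<alpha>i \<circ> \<beta>) (Some 0) = Some 0"
    using ai(2) by (metis comp_apply id_apply)
  then obtain l where l: "leading_term (\<alpha>i \<circ> \<beta>) 1 l"
    using leading_term_moebius_transformation moebius_transformation_comp[OF ai(1) 1(2)] by blast
  have "G \<circ> F \<circ> \<alpha> = G \<circ> (\<alpha>' \<circ> \<alpha>i) \<circ> \<beta> \<circ> L" using 1(4) ai by (simp add: comp_assoc)
  also have "\<dots> = (G \<circ> \<alpha>') \<circ> (\<alpha>i \<circ> \<beta> \<circ> L)" by (simp add: comp_assoc)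
  also have "\<dots> = \<beta>' \<circ> (L' \<circ> ((\<alpha>i \<circ> \<beta>) \<circ> L))" unfolding 2(4) by (simp add: comp_assoc)
  finally have e: "G \<circ> F \<circ> \<alpha> = \<beta>' \<circ> (L' \<circ> ((\<alpha>i \<circ> \<beta>) \<circ> L))" .
  have "leading_term (L' \<circ> ((\<alpha>i \<circ> \<beta>) \<circ> L)) (n * 1 * m) (c' * (l * c ^ 1) ^ m)"
    by (intro leading_term_comp 1 2 l)
  then show ?thesis
    unfolding has_local_degree_def using e 1 2 by auto
qed

lemma has_local_degree_moebius:
  assumes "moebius_transformation \<mu>"
  shows "has_local_degree \<mu> x 1"
proof -
  obtain \<alpha> where "moebius_transformation \<alpha>" "\<alpha> (Some 0) = x" by (rule moebius_transformation_to_zero)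
  then show ?thesis unfolding has_local_degree_def
    using moebius_transformation_comp[OF assms] leading_term_id
    by (intro exI[of _ \<alpha>] exI[of _ "\<mu> \<circ> \<alpha>"] exI[of _ id] exI[of _ 1]) auto
qed

text \<open>
  If \<open>F \<circ> \<alpha>\<close> behaves like \<open>c t ^ n\<close> and \<open>h\<close> like \<open>l t\<close>, then invariance of \<open>F \<circ> \<alpha>\<close> under \<open>h\<close>
  means \<open>c l ^ n = c\<close>. This bounds the derivative of a deck transformation at a fixed point.
\<close>

lemma multiplier_power_eq_1:
  assumes "has_local_degree F (\<alpha> (Some 0)) n" "moebius_transformation \<alpha>"
    and "F \<circ> \<alpha> \<circ> h = F \<circ> \<alpha>" "leading_term h 1 l"
  shows "l ^ n = 1"
proof -
  have "has_local_degree (F \<circ> \<alpha>) (Some 0) (1 * n)"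
    by (intro has_local_degree_comp has_local_degree_moebius assms)
  then obtain \<gamma> \<beta> L c where 1: "moebius_transformation \<gamma>" "moebius_transformation \<beta>"
     "\<gamma> (Some 0) = Some 0" "F \<circ> \<alpha> \<circ> \<gamma> = \<beta> \<circ> L" "leading_term L n c"
    unfolding has_local_degree_def by auto
  obtain \<gamma>i where gi: "moebius_transformation \<gamma>i" "\<gamma>i \<circ> \<gamma> = id" "\<gamma> \<circ> \<gamma>i = id"
    using moebius_transformation_inverse[OF 1(1)] .
  have "\<gamma>i (Some 0) = Some 0" using gi(2) 1(3) by (metis comp_apply id_apply)
  then obtain k where k: "leading_term \<gamma>i 1 k"
    using leading_term_moebius_transformation gi(1) by blast
  define K where "K = L \<circ> \<gamma>i"
  have K: "leading_term K n (c * k ^ n)"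
    unfolding K_def using leading_term_comp[OF k 1(5)] by simp
  have "F \<circ> \<alpha> = F \<circ> \<alpha> \<circ> (\<gamma> \<circ> \<gamma>i)" using gi by simp
  also have "\<dots> = \<beta> \<circ> K" unfolding K_def using 1(4) by (simp add: comp_assoc[symmetric])
  finally have FK: "F \<circ> \<alpha> = \<beta> \<circ> K" .
  have "K \<circ> h = K"
  proof
    fix x
    have "\<beta> ((K \<circ> h) x) = \<beta> (K x)" using assms(3) unfolding FK by (metis comp_apply)
    then show "(K \<circ> h) x = K x"
      using moebius_transformation_bij[OF 1(2)] by (simp add: bij_def inj_eq)
  qed
  then have "leading_term K (1 * n) (c * k ^ n * l ^ n)"
    using leading_term_comp[OF assms(4) K] by simp
  from leading_term_unique(2)[OF this K] have "c * k ^ n * l ^ n = c * k ^ n" .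
  moreover have "c * k ^ n \<noteq> 0" using K unfolding leading_term_def by blast
  ultimately show ?thesis by (metis mult_cancel_left2)
qed

lemma leading_term_funpow:
  assumes "leading_term h 1 l"
  shows "leading_term (h ^^ m) 1 (l ^ m)"
proof (induction m)
  case 0
  then show ?case using leading_term_id by (simp add: id_def)
next
  case (Suc m)
  show ?case using leading_term_comp[OF Suc assms] by (simp only: funpow.simps power_Suc mult_1_left power_one_right)
qed

text \<open>
  A transformation that fixes \<open>0\<close> with derivative \<open>1\<close> has the form \<open>z / (e z + 1)\<close>, and its \<open>j\<close>-th
  iterate is \<open>z / (j e z + 1)\<close>. Hence finite order forces \<open>e = 0\<close>: in a finite group,
  an element that fixes a given point is determined by its derivative there.
\<close>

lemma finite_order_multiplier_1:
  assumes "moebius_transformation h" "leading_term h 1 1" "h ^^ m = id" "m \<ge> 1"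
  shows "h = id"
proof -
  obtain a b c d where m: "a * d - b * c \<noteq> 0" "h = moebius a b c d"
    using assms unfolding moebius_transformation_def by blast
  have h0: "h (Some 0) = Some 0" using assms by (simp add: leading_term_def)
  have b: "d \<noteq> 0" "b = 0" using h0 unfolding m(2)
    by (auto simp: moebius_def hom_point_def split: if_splits)
  then have "a \<noteq> 0" using m by auto
  then have "a / d = 1"
    using leading_term_unique(2)[OF leading_term_moebius[of d a c]] b m assms(2) by blast
  then have da: "d = a" using b by simp
  have "h = moebius a 0 c a" using m b da by simp
  also have "\<dots> = moebius 1 0 (c / a) 1"
  proof
    fix x
    obtain u v where x: "x = hom_point u v" "u \<noteq> 0 \<or> v \<noteq> 0" by (rule hom_point_cases)
    show "moebius a 0 c a x = moebius 1 0 (c / a) 1 x"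
      using hom_point_scale[OF \<open>a \<noteq> 0\<close>, of u "c / a * u + v"] x \<open>a \<noteq> 0\<close>
      by (simp add: moebius_hom_point algebra_simps)
  qed
  finally have h: "h = moebius 1 0 (c / a) 1" .
  have "h ^^ j = moebius 1 0 (of_nat j * (c / a)) 1" for j
  proof (induction j)
    case 0
    then show ?case by (simp add: moebius_diagonal id_def)
  next
    case (Suc j)
    then show ?case by (simp add: h moebius_comp algebra_simps)
  qed
  then have "moebius 1 0 (of_nat m * (c / a)) 1 = id" using assms by metis
  then have "moebius 1 0 (of_nat m * (c / a)) 1 None = None" by simp
  then have "c = 0" unfolding moebius_fixes_None using assms \<open>a \<noteq> 0\<close> by simp
  then show ?thesis using h by (simp add: moebius_diagonal)
qed

section \<open>Finite groups of transformations\<close>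

definition transformation_group :: "('a \<Rightarrow> 'a) set \<Rightarrow> bool" where
  "transformation_group G \<longleftrightarrow> id \<in> G \<and> (\<forall>g\<in>G. \<forall>h\<in>G. g \<circ> h \<in> G) \<and>
     (\<forall>g\<in>G. \<exists>h\<in>G. h \<circ> g = id \<and> g \<circ> h = id)"

text \<open>
  This presentation gives access to the orbit-stabiliser theorem and to Sylow's theorem.
\<close>

definition composition_monoid :: "('a \<Rightarrow> 'a) set \<Rightarrow> ('a \<Rightarrow> 'a) monoid" where
  "composition_monoid G = \<lparr>carrier = G, mult = (\<circ>), one = id\<rparr>"

lemma transformation_group_comp:
  "transformation_group G \<Longrightarrow> g \<in> G \<Longrightarrow> h \<in> G \<Longrightarrow> g \<circ> h \<in> G"
  by (simp add: transformation_group_def)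

lemma transformation_group_inverse:
  assumes "transformation_group G" "g \<in> G"
  obtains h where "h \<in> G" "h \<circ> g = id" "g \<circ> h = id"
  using assms unfolding transformation_group_def by blast

lemma group_composition_monoid:
  assumes "transformation_group G"
  shows "group (composition_monoid G)"
proof (rule groupI)
  fix g assume "g \<in> carrier (composition_monoid G)"
  then have "g \<in> G" by (simp add: composition_monoid_def)
  then show "\<exists>h\<in>carrier (composition_monoid G). h \<otimes>\<^bsub>composition_monoid G\<^esub> g = \<one>\<^bsub>composition_monoid G\<^esub>"
    using transformation_group_inverse[OF assms] by (auto simp: composition_monoid_def)
qed (use assms in \<open>auto simp: composition_monoid_def transformation_group_def comp_assoc\<close>)

lemma funpow_card_transformation_group:
  assumes G: "transformation_group G" "finite G" and "g \<in> G"
  shows "g ^^ card G = id"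
proof -
  interpret group "composition_monoid G" by (rule group_composition_monoid[OF G(1)])
  have pow: "g [^]\<^bsub>composition_monoid G\<^esub> n = g ^^ n" for n :: nat
  proof (induction n)
    case 0
    then show ?case by (simp add: composition_monoid_def id_def)
  next
    case (Suc n)
    then show ?case unfolding nat_pow_Suc funpow_Suc_right
      by (simp add: composition_monoid_def)
  qed
  have "g [^]\<^bsub>composition_monoid G\<^esub> Coset.order (composition_monoid G) = \<one>\<^bsub>composition_monoid G\<^esub>"
    using assms by (intro pow_order_eq_1) (simp_all add: composition_monoid_def)
  then show ?thesis unfolding pow by (simp add: composition_monoid_def Coset.order_def)
qed

lemma transformation_group_subgroup:
  assumes "transformation_group G" "subgroup H (composition_monoid G)"
  shows "transformation_group H" "H \<subseteq> G"
proof -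
  interpret group "composition_monoid G" by (rule group_composition_monoid[OF assms(1)])
  interpret H: subgroup H "composition_monoid G" by fact
  show "H \<subseteq> G" using H.subset by (simp add: composition_monoid_def)
  show "transformation_group H"
    unfolding transformation_group_def
  proof (intro conjI ballI)
    show "id \<in> H" using H.one_closed by (simp add: composition_monoid_def)
    fix g assume g: "g \<in> H"
    show "\<exists>h\<in>H. h \<circ> g = id \<and> g \<circ> h = id"
      using H.m_inv_closed[OF g] l_inv[OF H.mem_carrier[OF g]] r_inv[OF H.mem_carrier[OF g]]
      by (auto simp: composition_monoid_def)
    fix h assume "h \<in> H"
    then show "g \<circ> h \<in> H" using H.m_closed[OF g] by (simp add: composition_monoid_def)
  qed
qed

lemma card_orbit_stabilizer:
  assumes G: "transformation_group G"
  shows "card ((\<lambda>g. g x) ` G) * card {g \<in> G. g x = x} = card G"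
proof -
  interpret group "composition_monoid G" by (rule group_composition_monoid[OF G])
  have bij: "bij g" if "g \<in> G" for g
    using transformation_group_inverse[OF G that] o_bij by metis
  interpret group_action "composition_monoid G" UNIV "\<lambda>g. g"
  proof (rule group_action.intro, rule group_hom.intro[OF _ _ group_hom_axioms.intro])
    show "(\<lambda>g. g) \<in> hom (composition_monoid G) (BijGroup UNIV)"
      using bij by (auto simp: hom_def composition_monoid_def BijGroup_def Bij_def extensional_def
          compose_def restrict_def fun_eq_iff)
  qed (simp_all add: group_axioms group_BijGroup)
  have "orbit (composition_monoid G) (\<lambda>g. g) x = (\<lambda>g. g x) ` G"
    "stabilizer (composition_monoid G) (\<lambda>g. g) x = {g \<in> G. g x = x}"
    by (auto simp: orbit_def stabilizer_def composition_monoid_def)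
  then show ?thesis using orbit_stabilizer_theorem[of x]
    by (simp add: Coset.order_def composition_monoid_def)
qed

text \<open>
  The set \<open>X\<close> splits into orbits, each of which is in bijection with \<open>G\<close>.
\<close>

lemma free_action_card_dvd:
  assumes G: "transformation_group G" and X: "finite X" "\<And>g x. g \<in> G \<Longrightarrow> x \<in> X \<Longrightarrow> g x \<in> X"
    and free: "\<And>g x. g \<in> G \<Longrightarrow> x \<in> X \<Longrightarrow> g x = x \<Longrightarrow> g = id"
  shows "card G dvd card X"
proof -
  define orb where "orb = (\<lambda>x. (\<lambda>g. g x) ` G)"
  have id: "id \<in> G" using G by (simp add: transformation_group_def)
  have sub: "orb y \<subseteq> orb x" if yx: "y \<in> orb x" for x y
  proof
    fix z assume "z \<in> orb y"
    then obtain g h where "z = g y" "g \<in> G" "y = h x" "h \<in> G" using yx by (auto simp: orb_def)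
    then show "z \<in> orb x" unfolding orb_def
      using transformation_group_comp[OF G] by (intro image_eqI[of _ _ "g \<circ> h"]) auto
  qed
  have sym: "x \<in> orb y" if yx: "y \<in> orb x" for x y
  proof -
    obtain g where "g \<in> G" "y = g x" using yx by (auto simp: orb_def)
    moreover obtain h where "h \<in> G" "h \<circ> g = id"
      using transformation_group_inverse[OF G \<open>g \<in> G\<close>] by blast
    ultimately show ?thesis unfolding orb_def
      by (intro image_eqI[of _ _ h]) (auto simp: fun_eq_iff)
  qed
  have un: "\<Union> (orb ` X) = X"
  proof
    show "\<Union> (orb ` X) \<subseteq> X" using X by (auto simp: orb_def)
    show "X \<subseteq> \<Union> (orb ` X)"
    proof
      fix x assume "x \<in> X"
      moreover have "id x \<in> orb x" using id unfolding orb_def by (rule imageI)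
      ultimately show "x \<in> \<Union> (orb ` X)" by auto
    qed
  qed
  have "card G dvd card (\<Union> (orb ` X))"
  proof (rule dvd_partition)
    show "finite (\<Union> (orb ` X))" unfolding un by fact
    show "\<forall>c\<in>orb ` X. card G dvd card c"
    proof
      fix c assume "c \<in> orb ` X"
      then obtain x where x: "x \<in> X" "c = orb x" by blast
      have "inj_on (\<lambda>g. g x) G"
      proof (rule inj_onI)
        fix g h assume gh: "g \<in> G" "h \<in> G" "g x = h x"
        obtain k where k: "k \<in> G" "k \<circ> g = id" "g \<circ> k = id"
          using transformation_group_inverse[OF G gh(1)] by blast
        have "(k \<circ> h) x = x" using gh(3) k(2) by (metis comp_apply id_apply)
        then have "k \<circ> h = id" using free[of "k \<circ> h" x] transformation_group_comp[OF G k(1) gh(2)] x by blast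
        then have "g \<circ> (k \<circ> h) = g" by simp
        then show "g = h" using k(3) by (simp add: comp_assoc[symmetric])
      qed
      then show "card G dvd card c" using x by (simp add: orb_def card_image)
    qed
    show "\<forall>c1\<in>orb ` X. \<forall>c2\<in>orb ` X. c1 \<noteq> c2 \<longrightarrow> c1 \<inter> c2 = {}"
    proof (intro ballI impI)
      fix c1 c2 assume c: "c1 \<in> orb ` X" "c2 \<in> orb ` X" "c1 \<noteq> c2"
      then obtain x y where xy: "c1 = orb x" "c2 = orb y" by blast
      show "c1 \<inter> c2 = {}"
      proof (rule ccontr)
        assume "c1 \<inter> c2 \<noteq> {}"
        then obtain z where z: "z \<in> orb x" "z \<in> orb y" using xy by blast
        then have "orb x = orb z" "orb y = orb z" using sub sym by blast+
        then show False using c xy by simp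
      qed
    qed
  qed
  then show ?thesis by (simp add: un)
qed

text \<open>
  Lagrange's theorem, as the free action of \<open>R\<close> on \<open>G\<close> by left multiplication.
\<close>

lemma subgroup_card_dvd:
  assumes R: "transformation_group R" and G: "transformation_group G" "finite G" and "R \<subseteq> G"
  shows "card R dvd card G"
proof -
  define left :: "('a \<Rightarrow> 'a) \<Rightarrow> ('a \<Rightarrow> 'a) \<Rightarrow> 'a \<Rightarrow> 'a" where "left = (\<circ>)"
  have group: "transformation_group (left ` R)"
    unfolding transformation_group_def
  proof (intro conjI ballI)
    have "left id = id" by (simp add: left_def fun_eq_iff)
    moreover have "id \<in> R" using R by (simp add: transformation_group_def)
    ultimately show "id \<in> left ` R" by (metis imageI)
    fix g assume "g \<in> left ` R"
    then obtain r where r: "r \<in> R" "g = left r" by blast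
    obtain s where s: "s \<in> R" "s \<circ> r = id" "r \<circ> s = id"
      using transformation_group_inverse[OF R r(1)] .
    have "left s \<circ> g = id" "g \<circ> left s = id"
      unfolding r(2) using s by (simp_all add: left_def fun_eq_iff)
    then show "\<exists>h\<in>left ` R. h \<circ> g = id \<and> g \<circ> h = id" using s(1) by blast
    fix h assume "h \<in> left ` R"
    then obtain u where u: "u \<in> R" "h = left u" by blast
    have "g \<circ> h = left (r \<circ> u)" unfolding r(2) u(2) by (simp add: left_def fun_eq_iff)
    then show "g \<circ> h \<in> left ` R" using transformation_group_comp[OF R r(1) u(1)] by blast
  qed
  have closed: "g h \<in> G" if gh: "g \<in> left ` R" "h \<in> G" for g h
  proof -
    obtain r where r: "r \<in> R" "g = left r" using gh by blast
    have "r \<in> G" using r \<open>R \<subseteq> G\<close> by blast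
    then have "r \<circ> h \<in> G" using \<open>h \<in> G\<close> by (rule transformation_group_comp[OF G(1)])
    then show ?thesis using r(2) by (simp add: left_def)
  qed
  have free: "g = id" if gh: "g \<in> left ` R" "h \<in> G" and fixed: "g h = h" for g h
  proof -
    obtain r where r: "r \<in> R" "g = left r" using gh by blast
    obtain k where "h \<circ> k = id" using transformation_group_inverse[OF G(1) \<open>h \<in> G\<close>] .
    moreover have "r \<circ> h = h" using fixed r(2) by (simp add: left_def)
    ultimately have "r = id" by (metis comp_assoc comp_id)
    then show ?thesis using r by (simp add: left_def fun_eq_iff)
  qed
  have "card (left ` R) dvd card G"
    by (rule free_action_card_dvd[where G = "left ` R" and X = G]) (fact group, fact G(2), fact closed, fact free)
  moreover have "inj_on left R"
  proof (rule inj_onI)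
    fix r s :: "'a \<Rightarrow> 'a" assume "left r = left s"
    then have "left r id = left s id" by (rule fun_cong)
    then show "r = s" by (simp add: left_def)
  qed
  ultimately show ?thesis by (simp add: card_image)
qed

section \<open>Arithmetic of orbit lengths\<close>

text \<open>
  The two lemmas below restrict the lengths of orbits that meet the critical set in one or in two
  points. Here every common divisor of \<open>m\<close> and \<open>d\<close> divides \<open>1\<close>, so \<open>m\<close> is coprime to \<open>d ^ K\<close>,
  which it divides.
\<close>

lemma orbit_length_1:
  fixes m d K :: nat
  assumes "m dvd d ^ K" "d dvd m - 1" "m \<ge> 1"
  shows "m = 1"
proof -
  have "coprime m d"
  proof (rule coprimeI)
    fix c assume c: "c dvd m" "c dvd d"
    then have "c dvd m - 1" using assms dvd_trans by blast
    then have "c dvd m - (m - 1)" by (rule dvd_diff_nat[OF c(1)])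
    then show "is_unit c" using assms(3) by simp
  qed
  then have "coprime m (d ^ K)" by simp
  then show ?thesis using assms by (metis coprime_absorb_left nat_dvd_1_iff_1)
qed

text \<open>
  Every common divisor of \<open>m\<close> and \<open>d\<close> divides \<open>2\<close>, so an odd divisor of \<open>m\<close> is coprime to \<open>d\<close> and
  must be \<open>1\<close>. Thus \<open>m\<close> is a power of \<open>2\<close>, and being neither \<open>1\<close> nor \<open>2\<close> it is divisible by
  \<open>4\<close>; then \<open>4\<close> cannot divide \<open>d\<close>.
\<close>

lemma orbit_length_2:
  fixes m d K :: nat
  assumes "m dvd d ^ K" "d dvd m - 2" "m \<ge> 2" "m \<noteq> 2"
  shows "4 dvd m" "d mod 4 = 2"
proof -
  have common: "c dvd 2" if "c dvd m" "c dvd d" for c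
  proof -
    have "c dvd m - 2" using that assms dvd_trans by blast
    then have "c dvd m - (m - 2)" by (rule dvd_diff_nat[OF that(1)])
    then show ?thesis unfolding diff_diff_cancel[OF assms(3)] .
  qed
  have odd_part: "k = 1" if "k dvd m" "odd k" for k
  proof -
    have "coprime k d"
    proof (rule coprimeI)
      fix c assume c: "c dvd k" "c dvd d"
      then have "c dvd 2" using common that dvd_trans by blast
      moreover have "odd c" using c that dvd_trans by blast
      ultimately show "is_unit c"
        by (metis dvd_imp_le le_antisym less_2_cases linorder_not_le nat_dvd_1_iff_1 odd_pos One_nat_def even_zero dvd_refl zero_less_numeral)
    qed
    then have "coprime k (d ^ K)" by simp
    moreover have "k dvd d ^ K" using that assms dvd_trans by blast
    ultimately show ?thesis by (metis coprime_absorb_left nat_dvd_1_iff_1)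
  qed
  have "even m" using odd_part[of m] assms by fastforce
  then obtain k where k: "m = 2 * k" by blast
  have "even k"
  proof (rule ccontr)
    assume "odd k"
    then have "k = 1" using odd_part[of k] k by simp
    then show False using k assms by simp
  qed
  then show 4: "4 dvd m" using k by auto
  have "even d"
  proof (rule ccontr)
    assume "odd d"
    then have "odd (d ^ K)" by simp
    then show False using \<open>even m\<close> assms(1) dvd_trans by blast
  qed
  moreover have "\<not> 4 dvd d" using common[of 4] 4 by auto
  ultimately show "d mod 4 = 2" by presburger
qed

section \<open>Groups of Moebius transformations\<close>

lemma funpow_semiconj:
  assumes "h \<circ> \<alpha> = \<alpha> \<circ> k"
  shows "h ^^ n \<circ> \<alpha> = \<alpha> \<circ> k ^^ n"
proof (induction n)
  case 0
  then show ?case by simp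
next
  case (Suc n)
  have "h ^^ Suc n \<circ> \<alpha> = h \<circ> (h ^^ n \<circ> \<alpha>)" by (simp add: comp_assoc)
  also have "\<dots> = (h \<circ> \<alpha>) \<circ> k ^^ n" unfolding Suc by (simp add: comp_assoc)
  also have "\<dots> = \<alpha> \<circ> k ^^ Suc n" unfolding assms by (simp add: comp_assoc)
  finally show ?case .
qed

lemma order_8_multipliers:
  fixes l :: complex and d :: nat
  assumes "d mod 4 = 2" "l ^ d = 1" "l ^ 8 = 1"
  shows "l ^ 2 = 1"
proof -
  have "l ^ d = l ^ (8 * (d div 8) + d mod 8)" by simp
  also have "\<dots> = l ^ (d mod 8)" unfolding power_add power_mult using assms by simp
  finally have *: "l ^ (d mod 8) = 1" using assms by simp
  have "d mod 8 = 2 \<or> d mod 8 = 6" using assms(1) by presburger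
  then show ?thesis
  proof
    assume "d mod 8 = 6"
    then have "l ^ 6 = 1" using * by simp
    moreover have "l ^ 8 = l ^ 6 * l ^ 2" by (simp flip: power_add)
    ultimately show ?thesis using assms by simp
  qed (use * in simp)
qed

lemma conjugate_to_zero:
  assumes "moebius_transformation \<mu>" "moebius_transformation \<alpha>" "\<mu> (\<alpha> (Some 0)) = \<alpha> (Some 0)"
  obtains k l where "moebius_transformation k" "\<mu> \<circ> \<alpha> = \<alpha> \<circ> k" "leading_term k 1 l"
proof -
  obtain \<beta> where b: "moebius_transformation \<beta>" "\<beta> \<circ> \<alpha> = id" "\<alpha> \<circ> \<beta> = id"
    using moebius_transformation_inverse[OF assms(2)] .
  have k: "moebius_transformation (\<beta> \<circ> \<mu> \<circ> \<alpha>)"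
    using assms b by (intro moebius_transformation_comp)
  have "(\<beta> \<circ> \<mu> \<circ> \<alpha>) (Some 0) = Some 0"
    using b(2) assms(3) by (simp add: fun_eq_iff)
  then obtain l where "leading_term (\<beta> \<circ> \<mu> \<circ> \<alpha>) 1 l"
    using leading_term_moebius_transformation[OF k] by blast
  moreover have "\<mu> \<circ> \<alpha> = \<alpha> \<circ> (\<beta> \<circ> \<mu> \<circ> \<alpha>)" using b(3) by (simp add: comp_assoc[symmetric])
  ultimately show ?thesis using that k by blast
qed

text \<open>
  The hypothesis on multipliers says that the derivative of an element at a fixed point is a \<open>d\<close>-th
  root of unity. Being also an \<open>8\<close>-th root of unity, it is \<open>\<plusminus>1\<close>, and since the derivative
  determines the element, every element is an involution and \<open>H\<close> is commutative. Take a fixed point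
  \<open>x\<close> of some \<open>t \<noteq> id\<close>. Its orbit lies in the fixed point set of \<open>t\<close>, which has at most two points,
  and its stabiliser embeds in \<open>{1, -1}\<close> by the derivative. Hence \<open>H\<close> has at most four elements.
\<close>

lemma no_moebius_group_of_order_8:
  assumes H: "transformation_group H" "card H = 8"
    and moeb: "\<And>h. h \<in> H \<Longrightarrow> moebius_transformation h"
    and d: "d mod 4 = 2"
    and mult: "\<And>h \<alpha> k l. h \<in> H \<Longrightarrow> moebius_transformation \<alpha> \<Longrightarrow> h \<circ> \<alpha> = \<alpha> \<circ> k \<Longrightarrow>
      leading_term k 1 l \<Longrightarrow> l ^ d = 1"
  shows False
proof -
  have fin: "finite H" using H by (intro card_ge_0_finite) simp
  have cancel: "k = id" if "moebius_transformation \<alpha>" "\<alpha> \<circ> k = \<alpha>" for \<alpha> k :: "riemann_sphere \<Rightarrow> riemann_sphere"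
  proof
    fix x
    have "\<alpha> (k x) = \<alpha> x" using that(2) by (metis comp_apply)
    then show "k x = id x" using moebius_transformation_bij[OF that(1)] by (simp add: bij_def inj_eq)
  qed
  have uncancel: "h = id" if un: "moebius_transformation \<alpha>" "h \<circ> \<alpha> = \<alpha>" for \<alpha> h :: "riemann_sphere \<Rightarrow> riemann_sphere"
  proof
    fix x
    obtain y where "x = \<alpha> y" using moebius_transformation_bij[OF un(1)] by (metis bij_def surjD)
    then show "h x = id x" using un(2) by (metis comp_apply id_apply)
  qed
  have invol: "h \<circ> h = id" if h: "h \<in> H" for h
  proof -
    obtain x where x: "h x = x" using moebius_transformation_fixed_point[OF moeb[OF h]] .
    obtain \<alpha> where a: "moebius_transformation \<alpha>" "\<alpha> (Some 0) = x"
      by (rule moebius_transformation_to_zero)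
    obtain k l where k: "moebius_transformation k" "h \<circ> \<alpha> = \<alpha> \<circ> k" "leading_term k 1 l"
      using conjugate_to_zero[OF moeb[OF h] a(1)] x a by metis
    have "h ^^ 8 = id" using funpow_card_transformation_group[OF H(1) fin h] H by simp
    then have "\<alpha> \<circ> k ^^ 8 = \<alpha>" using funpow_semiconj[OF k(2), of 8] by simp
    then have k8: "k ^^ 8 = id" by (rule cancel[OF a(1)])
    have "leading_term id 1 (l ^ 8)" using leading_term_funpow[OF k(3), of 8] unfolding k8 .
    from leading_term_unique(2)[OF this leading_term_id] have "l ^ 8 = 1" .
    then have "l ^ 2 = 1" using order_8_multipliers[OF d mult[OF h a(1) k(2,3)]] by blast
    then have lt: "leading_term (k ^^ 2) 1 1" using leading_term_funpow[OF k(3), of 2] by metis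
    have "k ^^ 2 = id"
    proof (rule finite_order_multiplier_1[OF _ lt, where m = 4])
      have "k ^^ 2 = k \<circ> k" by (simp add: numeral_2_eq_2)
      then show "moebius_transformation (k ^^ 2)" using moebius_transformation_comp[OF k(1,1)] by metis
      show "(k ^^ 2) ^^ 4 = id" unfolding funpow_mult using k8 by simp
    qed simp
    then have "h ^^ 2 \<circ> \<alpha> = \<alpha>" using funpow_semiconj[OF k(2), of 2] by simp
    then have "h ^^ 2 = id" by (rule uncancel[OF a(1)])
    then show ?thesis by (simp add: numeral_2_eq_2)
  qed
  have commute: "g \<circ> h = h \<circ> g" if "g \<in> H" "h \<in> H" for g h
  proof -
    have "(g \<circ> h) \<circ> (g \<circ> h) = id" using invol transformation_group_comp[OF H(1) that] by blast
    then have "h \<circ> ((g \<circ> h) \<circ> (g \<circ> h)) = h" by simp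
    moreover have "g \<circ> (h \<circ> h) \<circ> g = id" using invol that by simp
    ultimately show ?thesis using invol that by (metis comp_assoc comp_id id_comp)
  qed
  have "\<exists>t\<in>H. t \<noteq> id"
  proof (rule ccontr)
    assume "\<not> ?thesis"
    then have "H \<subseteq> {id}" by blast
    then have "card H \<le> card {id :: riemann_sphere \<Rightarrow> riemann_sphere}" by (intro card_mono) auto
    then show False using H by simp
  qed
  then obtain t where t: "t \<in> H" "t \<noteq> id" by blast
  obtain x where x: "t x = x" using moebius_transformation_fixed_point[OF moeb[OF t(1)]] .
  have "(\<lambda>g. g x) ` H \<subseteq> {y. t y = y}"
  proof clarify
    fix g assume "g \<in> H"
    then have "t (g x) = g (t x)" using commute[OF t(1)] by (metis comp_apply)
    then show "t (g x) = g x" using x by simp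
  qed
  then have "card ((\<lambda>g. g x) ` H) \<le> card {y. t y = y}"
    by (intro card_mono moebius_transformation_fixed_points(1)[OF moeb[OF t(1)] t(2)])
  then have orb: "card ((\<lambda>g. g x) ` H) \<le> 2"
    using moebius_transformation_fixed_points(2)[OF moeb[OF t(1)] t(2)] by linarith
  define S where "S = {g \<in> H. g x = x}"
  obtain \<alpha> where a: "moebius_transformation \<alpha>" "\<alpha> (Some 0) = x"
    by (rule moebius_transformation_to_zero)
  have mult_minus_1: "\<exists>k. moebius_transformation k \<and> g \<circ> \<alpha> = \<alpha> \<circ> k \<and> leading_term k 1 (-1)"
    if g: "g \<in> S" "g \<noteq> id" for g
  proof -
    have gH: "g \<in> H" using g by (simp add: S_def)
    obtain k l where k: "moebius_transformation k" "g \<circ> \<alpha> = \<alpha> \<circ> k" "leading_term k 1 l"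
      using conjugate_to_zero[OF moeb[OF gH] a(1)] a g by (auto simp: S_def)
    have "g ^^ 2 = id" using invol[OF gH] by (simp add: numeral_2_eq_2)
    then have "\<alpha> \<circ> k ^^ 2 = \<alpha>" using funpow_semiconj[OF k(2), of 2] by simp
    then have k2: "k ^^ 2 = id" by (rule cancel[OF a(1)])
    have "leading_term id 1 (l ^ 2)" using leading_term_funpow[OF k(3), of 2] unfolding k2 .
    from leading_term_unique(2)[OF this leading_term_id] have "l = 1 \<or> l = -1"
      by (simp add: power2_eq_1_iff)
    moreover have "l \<noteq> 1"
    proof
      assume "l = 1"
      then have "k = id" using finite_order_multiplier_1[OF k(1) _ k2] k(3) by simp
      then show False using uncancel[OF a(1)] k(2) g by simp
    qed
    ultimately show ?thesis using k by blast
  qed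
  have "card (S - {id}) \<le> Suc 0"
  proof -
    have "g = h" if gh: "g \<in> S - {id}" "h \<in> S - {id}" for g h
    proof -
      obtain k where k: "moebius_transformation k" "g \<circ> \<alpha> = \<alpha> \<circ> k" "leading_term k 1 (-1)"
        using mult_minus_1 gh by blast
      obtain m where m: "moebius_transformation m" "h \<circ> \<alpha> = \<alpha> \<circ> m" "leading_term m 1 (-1)"
        using mult_minus_1 gh by blast
      have ghH: "g \<in> H" "h \<in> H" using gh by (auto simp: S_def)
      have conj: "(g \<circ> h) \<circ> \<alpha> = \<alpha> \<circ> (k \<circ> m)" using k m by (metis comp_assoc)
      \<comment> \<open>Both derivatives are \<open>-1\<close>, so \<open>g \<circ> h\<close> has derivative \<open>1\<close> and is trivial.\<close>
      have lt: "leading_term (k \<circ> m) 1 1" using leading_term_comp[OF m(3) k(3)] by simp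
      have "(g \<circ> h) ^^ 2 = id" using invol[OF transformation_group_comp[OF H(1) ghH]]
        by (simp add: numeral_2_eq_2)
      then have "\<alpha> \<circ> (k \<circ> m) ^^ 2 = \<alpha>" using funpow_semiconj[OF conj, of 2] by simp
      then have "(k \<circ> m) ^^ 2 = id" by (rule cancel[OF a(1)])
      then have "k \<circ> m = id"
        using finite_order_multiplier_1[OF moebius_transformation_comp[OF k(1) m(1)] lt] by simp
      then have "g \<circ> h = id" using uncancel[OF a(1)] conj by simp
      then have "g \<circ> (h \<circ> h) = h" by (simp add: comp_assoc[symmetric])
      then show "g = h" using invol ghH by simp
    qed
    then show ?thesis using fin by (subst card_le_Suc0_iff_eq) (auto simp: S_def)
  qed
  then have "card S \<le> 2"
    using card_Diff1_le[of S id] card_Diff_singleton_if[of S id] by (auto split: if_splits)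
  then have "card ((\<lambda>g. g x) ` H) * card S \<le> 2 * 2" using orb by (intro mult_le_mono)
  then show False using card_orbit_stabilizer[OF H(1), of x] H(2) by (simp add: S_def)
qed

lemma transformation_group_Deck: "transformation_group (Deck F)"
  unfolding transformation_group_def
proof (intro conjI ballI)
  show "id \<in> Deck F" by (simp add: Deck_def moebius_transformation_id)
  fix g assume g: "g \<in> Deck F"
  obtain h where h: "moebius_transformation h" "h \<circ> g = id" "g \<circ> h = id"
    using g moebius_transformation_inverse by (auto simp: Deck_def)
  have "F \<circ> h = F \<circ> g \<circ> h" using g by (simp add: Deck_def)
  then have "F \<circ> h = F" using h by (simp add: comp_assoc)
  then show "\<exists>h\<in>Deck F. h \<circ> g = id \<and> g \<circ> h = id" using h by (auto simp: Deck_def)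
  fix k assume "k \<in> Deck F"
  then show "g \<circ> k \<in> Deck F" using g by (auto simp: Deck_def moebius_transformation_comp comp_assoc[symmetric])
qed

lemma Deck_comp_subset: "Deck F \<subseteq> Deck (g \<circ> F)"
  by (auto simp: Deck_def comp_assoc)

section \<open>Dynamics of a power map followed by a Moebius transformation\<close>

definition power_map :: "nat \<Rightarrow> riemann_sphere \<Rightarrow> riemann_sphere" where
  "power_map d = map_option (\<lambda>z. z ^ d)"

lemma local_degree_power_map:
  assumes "d \<ge> 1"
  shows "has_local_degree (power_map d) x (if x \<in> {Some 0, None} then d else 1)"
proof -
  have lt: "leading_term (power_map d) d 1"
  proof -
    have "\<forall>\<^sub>F t in at 0. 1 = (t::complex) ^ d / t ^ d"
      using eventually_neq_at_within[of 0 0] by eventually_elim simp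
    then have "((\<lambda>t::complex. t ^ d / t ^ d) \<longlongrightarrow> 1) (at 0)"
      by (rule Lim_transform_eventually[OF tendsto_const])
    then show ?thesis using assms unfolding leading_term_def
      by (intro conjI exI[of _ "\<lambda>t. t ^ d"]) (auto simp: power_map_def)
  qed
  consider "x = Some 0" | "x = None" | w where "x = Some w" "w \<noteq> 0" by (cases x) auto
  then show ?thesis
  proof cases
    case 1
    show ?thesis unfolding has_local_degree_def
      by (rule exI[of _ id], rule exI[of _ id], rule exI[of _ "power_map d"], rule exI[of _ 1])
        (use 1 lt in \<open>simp add: moebius_transformation_id\<close>)
  next
    case 2
    have "power_map d \<circ> moebius 0 1 1 0 = moebius 0 1 1 0 \<circ> power_map d"
      using assms by (auto simp: fun_eq_iff power_map_def moebius_def hom_point_def power_divide split: option.split)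
    then show ?thesis unfolding has_local_degree_def
      by (intro exI[of _ "moebius 0 1 1 0"] exI[of _ "power_map d"] exI[of _ 1])
        (use 2 lt in \<open>simp add: moebius_transformation_inversion moebius_def hom_point_def\<close>)
  next
    case 3
    define L where "L = moebius 1 (- (w ^ d)) 0 1 \<circ> power_map d \<circ> moebius 1 w 0 1"
    have shift: "moebius 1 b 0 1 (Some z) = Some (z + b)" for b z
      by (simp add: moebius_def hom_point_def)
    have s: "L (Some t) = Some ((t + w) ^ d - w ^ d)" for t
      by (simp add: L_def shift power_map_def)
    have "((\<lambda>t. (t + w) ^ d) has_field_derivative of_nat d * (0 + w) ^ (d - 1)) (at 0)"
      by (auto intro!: derivative_eq_intros)
    then have "((\<lambda>t. ((t + w) ^ d - w ^ d) / t ^ 1) \<longlongrightarrow> of_nat d * w ^ (d - 1)) (at 0)"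
      by (simp add: has_field_derivative_iff)
    then have "leading_term L 1 (of_nat d * w ^ (d - 1))"
      using 3 assms s unfolding leading_term_def by (auto intro!: exI[of _ "\<lambda>t. (t + w) ^ d - w ^ d"])
    moreover have "power_map d \<circ> moebius 1 w 0 1 = moebius 1 (w ^ d) 0 1 \<circ> L"
    proof -
      have "moebius 1 (w ^ d) 0 1 \<circ> moebius 1 (- (w ^ d)) 0 1 = id"
        by (simp add: moebius_comp moebius_diagonal)
      then show ?thesis unfolding L_def by (simp add: comp_assoc[symmetric])
    qed
    ultimately show ?thesis using 3 shift[of w 0] moebius_transformation_shift
      unfolding has_local_degree_def
      by (intro exI[of _ "moebius 1 w 0 1"] exI[of _ "moebius 1 (w ^ d) 0 1"] exI[of _ L]
          exI[of _ "of_nat d * w ^ (d - 1)"]) simp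
  qed
qed

lemma infinite_sphere: "infinite (UNIV :: riemann_sphere set)"
proof
  assume "finite (UNIV :: riemann_sphere set)"
  then have "finite (range (Some :: complex \<Rightarrow> _))" by (rule finite_subset[rotated]) simp
  then have "finite (UNIV :: complex set)" by (rule finite_imageD) simp
  then show False using infinite_UNIV_char_0 by blast
qed

lemma card_power_map_fibre:
  assumes "d \<ge> 1" "y \<notin> {Some 0, None}"
  shows "card {x. power_map d x = y} = d"
proof -
  obtain w where w: "y = Some w" "w \<noteq> 0" using assms by (cases y) auto
  then have "{x. power_map d x = y} = Some ` {z. z ^ d = w}"
    by (auto simp: power_map_def)
  then have "card {x. power_map d x = y} = card {z. z ^ d = w}" by (simp add: card_image)
  then show ?thesis using card_nth_roots[OF w(2)] assms by simp
qed

locale power_moebius_map =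
  fixes M :: "riemann_sphere \<Rightarrow> riemann_sphere" and d :: nat
  assumes moebius_M: "moebius_transformation M" and d: "d \<ge> 2"
begin

definition f :: "riemann_sphere \<Rightarrow> riemann_sphere" where "f = M \<circ> power_map d"

definition C :: "riemann_sphere set" where "C = {Some 0, None}"

definition hits :: "nat \<Rightarrow> riemann_sphere \<Rightarrow> nat" where
  "hits k x = card {j. j < k \<and> (f ^^ j) x \<in> C}"

lemma finite_C: "finite C" and card_C: "card C = 2"
  by (simp_all add: C_def)

lemma hits_0 [simp]: "hits 0 x = 0"
  by (simp add: hits_def)

lemma hits_Suc: "hits (Suc k) x = hits k x + (if (f ^^ k) x \<in> C then 1 else 0)"
proof -
  have "{j. j < Suc k \<and> (f ^^ j) x \<in> C} =
      (if (f ^^ k) x \<in> C then insert k {j. j < k \<and> (f ^^ j) x \<in> C} else {j. j < k \<and> (f ^^ j) x \<in> C})"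
    using less_Suc_eq by auto
  then show ?thesis by (simp add: hits_def)
qed

lemma hits_add: "hits (a + b) x = hits a x + hits b ((f ^^ a) x)"
proof (induction b)
  case (Suc b)
  have "(f ^^ b) ((f ^^ a) x) = (f ^^ (a + b)) x"
    by (simp add: funpow_add add.commute[of a])
  then show ?case using Suc by (simp add: hits_Suc)
qed simp

lemma hits_eq_0: "hits k x = 0 \<longleftrightarrow> (\<forall>j<k. (f ^^ j) x \<notin> C)"
  by (auto simp: hits_def)

lemma hits_le_1:
  assumes "\<And>c j. c \<in> C \<Longrightarrow> j \<ge> 1 \<Longrightarrow> (f ^^ j) c \<notin> C"
  shows "hits k x \<le> 1"
proof -
  have *: False if "i < j" "(f ^^ i) x \<in> C" "(f ^^ j) x \<in> C" for i j
  proof -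
    have "(f ^^ (j - i)) ((f ^^ i) x) = (f ^^ (j - i + i)) x" by (simp only: funpow_add comp_apply)
    moreover have "j - i \<ge> 1" using that by simp
    ultimately show False using assms[OF that(2), of "j - i"] that by (metis le_add_diff_inverse2 less_imp_le)
  qed
  then have "i = j" if "(f ^^ i) x \<in> C" "(f ^^ j) x \<in> C" for i j
    using that by (meson linorder_neqE_nat)
  then show ?thesis unfolding hits_def One_nat_def
    by (subst card_le_Suc0_iff_eq) auto
qed

lemma local_degree_iterate: "has_local_degree (f ^^ k) x (d ^ hits k x)"
proof (induction k)
  case 0
  then show ?case using has_local_degree_moebius[OF moebius_transformation_id, of x] by (simp add: id_def)
next
  case (Suc k)
  have "has_local_degree f y ((if y \<in> C then d else 1) * 1)" for y
    unfolding f_def C_def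
    by (intro has_local_degree_comp local_degree_power_map has_local_degree_moebius moebius_M) (use d in simp)
  from has_local_degree_comp[OF Suc this]
  have "has_local_degree (f ^^ Suc k) x (d ^ hits k x * ((if (f ^^ k) x \<in> C then d else 1) * 1))"
    by (simp only: funpow.simps)
  moreover have "d ^ hits k x * ((if (f ^^ k) x \<in> C then d else 1) * 1) = d ^ hits (Suc k) x"
    by (simp add: hits_Suc)
  ultimately show ?case by metis
qed

text \<open>
  Composition with a Moebius transformation does not change local degrees, and \<open>d \<ge> 2\<close> makes the
  exponent recoverable from the local degree \<open>d ^ hits K x\<close>.
\<close>

lemma hits_Deck:
  assumes "g \<in> Deck (f ^^ K)"
  shows "hits K (g x) = hits K x"
proof -
  have g: "moebius_transformation g" "f ^^ K \<circ> g = f ^^ K" using assms by (auto simp: Deck_def)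
  have "has_local_degree (f ^^ K \<circ> g) x (1 * d ^ hits K (g x))"
    by (intro has_local_degree_comp has_local_degree_moebius local_degree_iterate g)
  then have "1 * d ^ hits K (g x) = d ^ hits K x"
    unfolding g(2) by (rule has_local_degree_unique[OF _ local_degree_iterate])
  then show ?thesis using d by simp
qed

text \<open>
  The hypothesis excludes critical values of the iterate: then all preimages of \<open>y\<close>
  along the way avoid the critical values \<open>f c\<close> of \<open>f\<close> and have exactly \<open>d\<close> preimages each.
\<close>

lemma card_fibre_iterate:
  assumes "\<And>j c. j < k \<Longrightarrow> c \<in> C \<Longrightarrow> (f ^^ Suc j) c \<noteq> y"
  shows "card {x. (f ^^ k) x = y} = d ^ k"
  using assms
proof (induction k)
  case 0
  then show ?case by simp
next
  case (Suc k)
  let ?U = "{u. (f ^^ k) u = y}"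
  have U: "card ?U = d ^ k" using Suc by simp
  have finU: "finite ?U" using U d by (intro card_ge_0_finite) simp
  have fib: "card {x. f x = u} = d" if "u \<in> ?U" for u
  proof -
    obtain N where N: "N \<circ> M = id" "M \<circ> N = id" using moebius_transformation_inverse[OF moebius_M] by metis
    have "{x. f x = u} = {x. power_map d x = N u}"
      using N by (auto simp: f_def fun_eq_iff)
    moreover have "N u \<notin> {Some 0, None}"
    proof
      assume "N u \<in> {Some 0, None}"
      then obtain c where c: "c \<in> C" "N u = c" by (auto simp: C_def)
      have "power_map d c = c" using c d by (auto simp: C_def power_map_def)
      then have "f c = u" using c N by (simp add: f_def fun_eq_iff) metis
      then have "(f ^^ Suc k) c = y" using that by (simp add: funpow_swap1)
      then show False using Suc.prems[of k c] c by simp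
    qed
    ultimately show ?thesis using card_power_map_fibre[of d "N u"] d by simp
  qed
  have "{x. (f ^^ Suc k) x = y} = (\<Union>u\<in>?U. {x. f x = u})"
    by (auto simp: funpow_swap1)
  also have "card \<dots> = (\<Sum>u\<in>?U. card {x. f x = u})"
  proof (rule card_UN_disjoint[OF finU])
    show "\<forall>u\<in>?U. finite {x. f x = u}" using fib d by (auto intro!: card_ge_0_finite)
  qed auto
  also have "\<dots> = d ^ Suc k" using fib U by simp
  finally show ?case .
qed

lemma generic_fibre:
  assumes "finite B"
  obtains y where "y \<notin> B" "card {x. (f ^^ K) x = y} = d ^ K"
proof -
  have "finite (B \<union> (\<Union>j<K. (\<lambda>c. (f ^^ Suc j) c) ` C))" using assms finite_C by simp
  then obtain y where "y \<notin> B \<union> (\<Union>j<K. (\<lambda>c. (f ^^ Suc j) c) ` C)"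
    using ex_new_if_finite[OF infinite_sphere] by blast
  then show ?thesis using that[of y] card_fibre_iterate[of K y] by blast
qed

text \<open>
  A deck transformation permutes each fibre and is determined by its values at three points. The
  bound \<open>K \<ge> 2\<close> ensures that a generic fibre, with \<open>d ^ K\<close> points, has at least three.
\<close>

lemma finite_Deck:
  assumes "K \<ge> 2"
  shows "finite (Deck (f ^^ K))"
proof -
  obtain y where y: "card {x. (f ^^ K) x = y} = d ^ K" using generic_fibre[of "{}"] by blast
  define S where "S = {x. (f ^^ K) x = y}"
  have "(2::nat) ^ 2 \<le> d ^ 2" using d by (rule power_mono) simp
  also have "\<dots> \<le> d ^ K" using d assms by (intro power_increasing) auto
  finally have S: "card S \<ge> 4" using y by (simp add: S_def)
  then have finS: "finite S" by (intro card_ge_0_finite) simp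
  have "inj_on (\<lambda>g. restrict g S) (Deck (f ^^ K))"
  proof (rule inj_onI)
    fix g h assume gh: "g \<in> Deck (f ^^ K)" "h \<in> Deck (f ^^ K)" "restrict g S = restrict h S"
    obtain k where k: "k \<in> Deck (f ^^ K)" "k \<circ> g = id" "g \<circ> k = id"
      using transformation_group_inverse[OF transformation_group_Deck gh(1)] .
    have "S \<subseteq> {x. (k \<circ> h) x = x}"
    proof
      fix x assume "x \<in> S"
      then have "h x = g x" using gh(3) by (metis restrict_apply')
      then show "x \<in> {x. (k \<circ> h) x = x}" using k(2) by (simp add: fun_eq_iff)
    qed
    moreover have m: "moebius_transformation (k \<circ> h)"
      using k(1) gh(2) by (auto simp: Deck_def intro: moebius_transformation_comp)
    ultimately have "k \<circ> h = id"
      using moebius_transformation_fixed_points[OF m] card_mono[of "{x. (k \<circ> h) x = x}" S] S by linarith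
    then have "g \<circ> (k \<circ> h) = g" by simp
    then show "g = h" using k(3) by (simp add: comp_assoc[symmetric])
  qed
  moreover have "(\<lambda>g. restrict g S) ` Deck (f ^^ K) \<subseteq> S \<rightarrow>\<^sub>E S"
  proof clarify
    fix g assume "g \<in> Deck (f ^^ K)"
    then have "g x \<in> S" if "x \<in> S" for x using that by (simp add: S_def Deck_def fun_eq_iff)
    then show "restrict g S \<in> S \<rightarrow>\<^sub>E S" by (simp add: restrict_PiE_iff)
  qed
  moreover have "finite (S \<rightarrow>\<^sub>E S)" using finS by (intro finite_PiE)
  ultimately show ?thesis using finite_imageD finite_subset by blast
qed

text \<open>
  A finite group of Moebius transformations has only finitely many points with nontrivial stabiliser,
  so it acts freely on a generic fibre.
\<close>

lemma card_Deck_dvd: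
  assumes "K \<ge> 2"
  shows "card (Deck (f ^^ K)) dvd d ^ K"
proof -
  let ?G = "Deck (f ^^ K)"
  have "finite (\<Union>g\<in>?G - {id}. {x. g x = x})"
    using finite_Deck[OF assms] moebius_transformation_fixed_points(1) by (auto simp: Deck_def)
  then have "finite ((f ^^ K) ` (\<Union>g\<in>?G - {id}. {x. g x = x}))" by (rule finite_imageI)
  then obtain y where y: "y \<notin> (f ^^ K) ` (\<Union>g\<in>?G - {id}. {x. g x = x})"
      "card {x. (f ^^ K) x = y} = d ^ K"
    by (rule generic_fibre[where K = K])
  have "card ?G dvd card {x. (f ^^ K) x = y}"
  proof (rule free_action_card_dvd[OF transformation_group_Deck])
    show "finite {x. (f ^^ K) x = y}" using y(2) d by (intro card_ge_0_finite) simp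
  next
    fix g x assume "g \<in> ?G" "x \<in> {x. (f ^^ K) x = y}"
    then show "g x \<in> {x. (f ^^ K) x = y}" by (auto simp: Deck_def fun_eq_iff)
  next
    fix g x assume "g \<in> ?G" "x \<in> {x. (f ^^ K) x = y}" "g x = x"
    then show "g = id" using y(1) by blast
  qed
  then show ?thesis using y by simp
qed

definition rotations :: "(riemann_sphere \<Rightarrow> riemann_sphere) set" where
  "rotations = (\<lambda>\<zeta>. moebius \<zeta> 0 0 1) ` {\<zeta>. \<zeta> ^ d = 1}"

lemma scale_apply: "moebius \<zeta> 0 0 1 (Some z) = Some (\<zeta> * z)" "\<zeta> \<noteq> 0 \<Longrightarrow> moebius \<zeta> 0 0 1 None = None"
  by (auto simp: moebius_def hom_point_def)

lemma root_of_unity_nonzero: "\<zeta> ^ d = 1 \<Longrightarrow> \<zeta> \<noteq> (0::complex)"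
  using d by (auto simp: power_0_left)

lemma card_rotations: "card rotations = d"
proof -
  have "inj_on (\<lambda>\<zeta>. moebius \<zeta> 0 0 1) {\<zeta>. \<zeta> ^ d = 1}"
  proof (rule inj_onI)
    fix \<zeta> \<xi> :: complex assume "moebius \<zeta> 0 0 1 = moebius \<xi> 0 0 1"
    then have "moebius \<zeta> 0 0 1 (Some 1) = moebius \<xi> 0 0 1 (Some 1)" by simp
    then show "\<zeta> = \<xi>" by (simp add: scale_apply)
  qed
  then have "card rotations = card {\<zeta>::complex. \<zeta> ^ d = 1}" by (simp add: rotations_def card_image)
  then show ?thesis using card_nth_roots[of 1 d] d by simp
qed

lemma transformation_group_rotations: "transformation_group rotations"
proof -
  have comp: "moebius \<zeta> 0 0 1 \<circ> moebius \<xi> 0 0 1 = moebius (\<zeta> * \<xi>) 0 0 1" if "\<xi> \<noteq> 0" for \<zeta> \<xi>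
    using that by (simp add: moebius_comp)
  show ?thesis unfolding transformation_group_def
  proof (intro conjI ballI)
    show "id \<in> rotations" unfolding rotations_def
      by (intro image_eqI[of _ _ 1]) (simp_all add: moebius_diagonal)
    fix g assume "g \<in> rotations"
    then obtain \<zeta> where z: "\<zeta> ^ d = 1" "g = moebius \<zeta> 0 0 1" by (auto simp: rotations_def)
    have nz: "\<zeta> \<noteq> 0" using root_of_unity_nonzero z by blast
    show "\<exists>h\<in>rotations. h \<circ> g = id \<and> g \<circ> h = id"
    proof
      show "moebius (1 / \<zeta>) 0 0 1 \<in> rotations"
        unfolding rotations_def using z by (auto simp: power_divide)
      show "moebius (1 / \<zeta>) 0 0 1 \<circ> g = id \<and> g \<circ> moebius (1 / \<zeta>) 0 0 1 = id"
        unfolding z using nz by (simp add: comp moebius_diagonal)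
    qed
    fix h assume "h \<in> rotations"
    then obtain \<xi> where x: "\<xi> ^ d = 1" "h = moebius \<xi> 0 0 1" by (auto simp: rotations_def)
    then show "g \<circ> h \<in> rotations"
      unfolding z x using comp[OF root_of_unity_nonzero[OF x(1)], of \<zeta>] z x
      by (auto simp: rotations_def power_mult_distrib)
  qed
qed

lemma rotations_fix_C: "r \<in> rotations \<Longrightarrow> c \<in> C \<Longrightarrow> r c = c"
  using root_of_unity_nonzero by (auto simp: rotations_def C_def scale_apply)

lemma rotations_free:
  assumes "r \<in> rotations" "x \<notin> C" "r x = x"
  shows "r = id"
proof -
  obtain \<zeta> where z: "\<zeta> ^ d = 1" "r = moebius \<zeta> 0 0 1" using assms by (auto simp: rotations_def)
  obtain w where w: "x = Some w" "w \<noteq> 0" using assms by (cases x) (auto simp: C_def)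
  then have "\<zeta> = 1" using assms(3) z by (simp add: scale_apply)
  then show ?thesis using z by (simp add: moebius_diagonal)
qed

lemma rotations_subset_Deck:
  assumes "K \<ge> 1"
  shows "rotations \<subseteq> Deck (f ^^ K)"
proof
  fix r assume "r \<in> rotations"
  then obtain \<zeta> where z: "\<zeta> ^ d = 1" "r = moebius \<zeta> 0 0 1" by (auto simp: rotations_def)
  have nz: "\<zeta> \<noteq> 0" using root_of_unity_nonzero z by blast
  have "power_map d (r x) = power_map d x" for x
    using z nz by (cases x) (auto simp: power_map_def scale_apply power_mult_distrib)
  then have "f \<circ> r = f" by (simp add: f_def fun_eq_iff)
  then have "r \<in> Deck f" using z nz by (simp add: Deck_def moebius_transformation_scale)
  moreover obtain K' where K': "K = Suc K'" using assms by (cases K) auto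
  have "f ^^ K = f ^^ K' \<circ> f" unfolding K' funpow_Suc_right ..
  ultimately show "r \<in> Deck (f ^^ K)" using Deck_comp_subset[of f "f ^^ K'"] by auto
qed

text \<open>
  Let \<open>m \<ge> 1\<close> be the time of the first visit of \<open>x\<close> to \<open>C\<close>, say at \<open>e\<close>. All hits of \<open>x\<close> up
  to time \<open>K\<close> are hits of \<open>e\<close> up to time \<open>K - m\<close>. As \<open>e\<close> has equally many hits up to time \<open>K\<close>, there
  are none from \<open>K - m\<close> to \<open>K - 1\<close>. The orbit of \<open>e\<close> takes the same value \<open>w\<close> at the times \<open>K - m\<close>
  and \<open>K\<close>, so \<open>w\<close> lies on a cycle, and that cycle avoids \<open>C\<close>. Since all critical points arrive at
  \<open>w\<close> at time \<open>K\<close>, the total number of hits of any critical point is its number of hits up to time \<open>K\<close>,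
  which is the same for both critical points. A critical orbit that returned to \<open>C\<close> would have more
  hits in total than the critical point it returns to.
\<close>

lemma critical_orbits_disjoint:
  assumes x: "x \<notin> C"
    and hits: "\<And>c. c \<in> C \<Longrightarrow> hits K c = hits K x"
    and same_value: "\<And>c. c \<in> C \<Longrightarrow> (f ^^ K) c = (f ^^ K) x"
    and "K \<ge> 1" "c \<in> C" "j \<ge> 1"
  shows "(f ^^ j) c \<notin> C"
proof -
  have pos: "hits K c \<ge> 1" if "c \<in> C" for c
  proof -
    have "hits K c \<noteq> 0" using that \<open>K \<ge> 1\<close> unfolding hits_eq_0 by (auto intro!: exI[of _ 0])
    then show ?thesis by simp
  qed
  have "hits K x \<noteq> 0" using pos[OF \<open>c \<in> C\<close>] hits[OF \<open>c \<in> C\<close>] by simp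
  then obtain i where i: "i < K" "(f ^^ i) x \<in> C" unfolding hits_eq_0 by blast
  define m where "m = (LEAST i. (f ^^ i) x \<in> C)"
  have m: "(f ^^ m) x \<in> C" unfolding m_def using i(2) by (rule LeastI)
  have "m \<le> i" unfolding m_def using i(2) by (rule Least_le)
  have before: "(f ^^ j) x \<notin> C" if "j < m" for j using that not_less_Least unfolding m_def by blast
  define e where "e = (f ^^ m) x"
  define b where "b = K - m"
  have K: "K = m + b" "K = b + m" using \<open>m \<le> i\<close> i by (simp_all add: b_def)
  have "m \<noteq> 0" using m x by (metis funpow_0)
  have e: "e \<in> C" using m by (simp add: e_def)
  have "hits m x = 0" using before by (simp add: hits_eq_0)
  then have "hits K x = hits b e" unfolding K(1) hits_add e_def by simp
  moreover have "hits K e = hits b e + hits m ((f ^^ b) e)" unfolding K(2) hits_add ..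
  ultimately have hm: "hits m ((f ^^ b) e) = 0" using hits[OF e] by simp
  define w where "w = (f ^^ b) e"
  have wx: "w = (f ^^ K) x" unfolding w_def e_def K(2) by (simp add: funpow_add)
  have "(f ^^ m) w = (f ^^ K) e" unfolding w_def K(1) by (simp add: funpow_add)
  then have per: "(f ^^ m) w = w" using same_value[OF e] wx by simp
  have wC: "(f ^^ j) w \<notin> C" for j
  proof -
    have "(f ^^ (j mod m)) w \<notin> C" using hm \<open>m \<noteq> 0\<close> by (simp add: hits_eq_0 w_def)
    then show ?thesis using funpow_mod_eq[OF per] by simp
  qed
  show ?thesis
  proof
    assume c': "(f ^^ j) c \<in> C"
    have "hits (K + j) c = hits K c + hits j w" unfolding hits_add using same_value[OF \<open>c \<in> C\<close>] wx by simp
    also have "hits j w = 0" using wC by (simp add: hits_eq_0)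
    finally have 1: "hits (K + j) c = hits K c" by simp
    have "hits (j + K) c = hits j c + hits K ((f ^^ j) c)" by (rule hits_add)
    also have "hits K ((f ^^ j) c) = hits K c" using hits[OF c'] hits[OF \<open>c \<in> C\<close>] by simp
    finally have "hits j c = 0" using 1 by (simp add: add.commute)
    then show False using \<open>j \<ge> 1\<close> \<open>c \<in> C\<close> unfolding hits_eq_0 by (metis funpow_0 less_le_trans less_one)
  qed
qed

text \<open>
  The orbit of a critical point under the deck group consists of critical points only. Passing from
  \<open>k\<close> to \<open>2 + k\<close> enlarges the deck group and guarantees that it is finite.
\<close>

theorem Deck_preserves_C:
  assumes "\<phi> \<in> Deck (f ^^ k)"
  shows "\<phi> ` C = C"
proof -
  define K where "K = 2 + k"
  have K: "K \<ge> 2" "K \<ge> 1" by (simp_all add: K_def)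
  define G where "G = Deck (f ^^ K)"
  have "f ^^ K = f ^^ 2 \<circ> f ^^ k" by (simp only: K_def funpow_add)
  then have phi: "\<phi> \<in> G" using assms Deck_comp_subset[of "f ^^ k" "f ^^ 2"] by (auto simp: G_def)
  have G: "transformation_group G" "finite G" "card G dvd d ^ K" "rotations \<subseteq> G"
    unfolding G_def using transformation_group_Deck finite_Deck card_Deck_dvd rotations_subset_Deck K by blast+
  have bij: "bij \<phi>" using phi moebius_transformation_bij by (simp add: G_def Deck_def)
  define orb where "orb = (\<lambda>x. (\<lambda>g. g x) ` G)"
  have self: "x \<in> orb x" for x
  proof -
    have "id \<in> G" using G(1) by (simp add: transformation_group_def)
    then have "id x \<in> orb x" unfolding orb_def by (rule imageI)
    then show ?thesis by simp
  qed
  have fin: "finite (orb x)" for x using G by (simp add: orb_def)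
  have closed: "g y \<in> orb x" if gy: "g \<in> G" "y \<in> orb x" for g x y
  proof -
    obtain h where "h \<in> G" "y = h x" using gy by (auto simp: orb_def)
    then show ?thesis unfolding orb_def using transformation_group_comp[OF G(1) gy(1)]
      by (intro image_eqI[of _ _ "g \<circ> h"]) auto
  qed
  have sym: "x \<in> orb y" if yx: "y \<in> orb x" for x y
  proof -
    obtain g where g: "g \<in> G" "y = g x" using yx by (auto simp: orb_def)
    obtain h where h: "h \<in> G" "h \<circ> g = id" using transformation_group_inverse[OF G(1) g(1)] .
    then have "h y = x" using g(2) by (simp add: fun_eq_iff)
    then show ?thesis using closed[OF h(1) self[of y]] by simp
  qed
  have "card (orb x) dvd card G" for x
    unfolding orb_def by (rule dvdI[OF card_orbit_stabilizer[OF G(1), symmetric]])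
  then have orb_dvd: "card (orb x) dvd d ^ K" for x using G(3) dvd_trans by blast
  have rot: "d dvd card (orb x - C)" for x
  proof -
    have "card rotations dvd card (orb x - C)"
    proof (rule free_action_card_dvd[OF transformation_group_rotations])
      fix r y assume r: "r \<in> rotations" and y: "y \<in> orb x - C"
      show "r y = y \<Longrightarrow> r = id" using rotations_free[OF r] y by blast
      have "r y \<notin> C"
      proof
        assume "r y \<in> C"
        then have "r (r y) = r y" using rotations_fix_C[OF r] by blast
        moreover have "bij r" using r G(4) moebius_transformation_bij by (auto simp: G_def Deck_def)
        ultimately have "r y = y" by (simp add: bij_def inj_eq)
        then show False using \<open>r y \<in> C\<close> y by simp
      qed
      then show "r y \<in> orb x - C" using closed[of r y x] r y G(4) by blast
    qed (use fin in simp)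
    then show ?thesis by (simp add: card_rotations)
  qed
  have single: "orb c = {c}" if "orb c \<inter> C = {c}" for c
  proof -
    have "orb c - C = orb c - {c}" using that by blast
    then have "d dvd card (orb c) - 1" using rot[of c] self[of c] fin[of c] by (simp add: card_Diff_singleton)
    moreover have "card (orb c) \<ge> 1" using self[of c] fin[of c] by (simp add: Suc_le_eq card_gt_0_iff) blast
    ultimately have "card (orb c) = 1" by (rule orbit_length_1[OF orb_dvd])
    then show ?thesis using self[of c] by (metis card_1_singletonE singletonD)
  qed
  show ?thesis
  proof (cases "None \<in> orb (Some 0)")
    case False
    then have "orb (Some 0) \<inter> C = {Some 0}" "orb None \<inter> C = {None}"
      using self sym by (auto simp: C_def)
    then have "orb (Some 0) = {Some 0}" "orb None = {None}" using single by blast+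
    then have "\<phi> (Some 0) = Some 0" "\<phi> None = None" using closed[OF phi self] by blast+
    then show ?thesis by (simp add: C_def)
  next
    case True
    define P where "P = orb (Some 0)"
    have CP: "C \<subseteq> P" using True self by (auto simp: C_def P_def)
    have finP: "finite P" using fin by (simp add: P_def)
    have "card P = 2"
    proof (rule ccontr)
      assume ne: "card P \<noteq> 2"
      have ge: "card P \<ge> 2" using card_mono[OF finP CP] by (simp add: card_C)
      have "d dvd card P - 2"
        using rot[of "Some 0"] card_Diff_subset[OF finite_C CP] by (simp add: P_def card_C)
      then have 4: "4 dvd card P" "d mod 4 = 2"
        using orbit_length_2[of "card P" d K] orb_dvd[of "Some 0"] ge ne by (auto simp: P_def)
      have "\<not> P \<subseteq> C" using card_mono[OF finite_C, of P] ge ne by (auto simp: card_C)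
      then obtain x where x: "x \<in> P" "x \<notin> C" by blast
      have inv: "hits K y = hits K (Some 0)" "(f ^^ K) y = (f ^^ K) (Some 0)" if y: "y \<in> P" for y
      proof -
        obtain g where g: "g \<in> Deck (f ^^ K)" "y = g (Some 0)" using y by (auto simp: P_def orb_def G_def)
        then show "hits K y = hits K (Some 0)" "(f ^^ K) y = (f ^^ K) (Some 0)"
          using hits_Deck[OF g(1)] by (auto simp: Deck_def fun_eq_iff)
      qed
      have "(f ^^ j) c \<notin> C" if "c \<in> C" "j \<ge> 1" for c j
      proof (rule critical_orbits_disjoint[OF x(2) _ _ K(2) that])
        fix c assume "c \<in> C"
        then have c: "c \<in> P" using CP by blast
        show "hits K c = hits K x" using inv(1)[OF c] inv(1)[OF x(1)] by simp
        show "(f ^^ K) c = (f ^^ K) x" using inv(2)[OF c] inv(2)[OF x(1)] by simp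
      qed
      \<comment> \<open>All local degrees of \<open>f ^^ K\<close> are therefore \<open>1\<close> or \<open>d\<close>.\<close>
      then have le1: "hits K y \<le> 1" for y by (rule hits_le_1)
      define S where "S = {g \<in> G. g (Some 0) = Some 0}"
      have S: "transformation_group S"
        unfolding transformation_group_def
      proof (intro conjI ballI)
        show "id \<in> S" using G(1) by (simp add: S_def transformation_group_def)
        fix g assume g: "g \<in> S"
        obtain h where h: "h \<in> G" "h \<circ> g = id" "g \<circ> h = id"
          using transformation_group_inverse[OF G(1)] g by (auto simp: S_def)
        then have "h (g (Some 0)) = Some 0" by (simp add: fun_eq_iff)
        then have "h \<in> S" using h g by (simp add: S_def)
        then show "\<exists>h\<in>S. h \<circ> g = id \<and> g \<circ> h = id" using h by blast
        fix k assume "k \<in> S"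
        then show "g \<circ> k \<in> S" using g transformation_group_comp[OF G(1)] by (simp add: S_def)
      qed
      have "rotations \<subseteq> S" using G(4) rotations_fix_C by (auto simp: S_def C_def)
      then have "d dvd card S"
        using subgroup_card_dvd[OF transformation_group_rotations S] G(2) by (simp add: card_rotations S_def)
      moreover have "2 dvd d" using 4(2) by presburger
      ultimately have "2 dvd card S" using dvd_trans by blast
      \<comment> \<open>The orbit contributes a factor \<open>4\<close>, the stabiliser of \<open>0\<close> a factor \<open>2\<close>.\<close>
      then have "4 * 2 dvd card P * card S" by (intro mult_dvd_mono 4)
      then have "8 dvd card G" using card_orbit_stabilizer[OF G(1), of "Some 0"]
        by (simp add: P_def orb_def S_def)
      then obtain n where "card G = 2 ^ 3 * n" by auto
      then have "Coset.order (composition_monoid G) = 2 ^ 3 * n"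
        by (simp add: Coset.order_def composition_monoid_def)
      moreover have "finite (carrier (composition_monoid G))" using G(2) by (simp add: composition_monoid_def)
      ultimately obtain H where H: "subgroup H (composition_monoid G)" "card H = 2 ^ 3"
        using sylow_thm[OF two_is_prime_nat group_composition_monoid[OF G(1)]] by blast
      have HG: "transformation_group H" "H \<subseteq> G" using transformation_group_subgroup[OF G(1) H(1)] .
      show False
      proof (rule no_moebius_group_of_order_8[OF HG(1) _ _ 4(2)])
        show "card H = 8" using H by simp
        show "moebius_transformation h" if "h \<in> H" for h using that HG(2) by (auto simp: G_def Deck_def)
        fix h \<alpha> k l assume h: "h \<in> H" and a: "moebius_transformation \<alpha>" and conj: "h \<circ> \<alpha> = \<alpha> \<circ> k"
          and k: "leading_term k 1 l"
        have "f ^^ K \<circ> h = f ^^ K" using h HG(2) by (auto simp: G_def Deck_def)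
        then have "f ^^ K \<circ> \<alpha> \<circ> k = f ^^ K \<circ> \<alpha>" using conj by (metis comp_assoc)
        then have "l ^ (d ^ hits K (\<alpha> (Some 0))) = 1"
          by (rule multiplier_power_eq_1[OF local_degree_iterate a _ k])
        moreover have "hits K (\<alpha> (Some 0)) = 0 \<or> hits K (\<alpha> (Some 0)) = 1"
          using le1[of "\<alpha> (Some 0)"] by linarith
        ultimately show "l ^ d = 1" by auto
      qed
    qed
    then have "C = P" using card_subset_eq[OF finP CP] by (simp add: card_C)
    then have "\<phi> ` C \<subseteq> C" using closed[OF phi] by (auto simp: P_def)
    moreover have "inj_on \<phi> C" using bij by (metis bij_is_inj inj_on_subset subset_UNIV)
    ultimately show ?thesis by (intro endo_inj_surj finite_C)
  qed
qed

end

text \<open>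
  From here on, \<open>order\<close>, \<open>smult\<close>, \<open>monom\<close> and \<open>coeff\<close> refer to polynomials rather than to
  groups and modules.
\<close>

hide_const (open) Coset.order Module.smult UnivPoly.monom UnivPoly.coeff

section \<open>Wronskians\<close>

text \<open>
  The numerator of the derivative of \<open>p / q\<close>; its roots are the finite critical points.
\<close>

definition wronskian :: "complex poly \<Rightarrow> complex poly \<Rightarrow> complex poly" where
  "wronskian p q = pderiv p * q - p * pderiv q"

text \<open>
  Writing \<open>r = (z - c) ^ e * u\<close> with \<open>u c \<noteq> 0\<close>, the lowest order term of the Wronskian at \<open>c\<close> is
  \<open>e * u c * s c * (z - c) ^ (e - 1)\<close>.
\<close>

lemma order_wronskian:
  assumes "r \<noteq> 0" "poly r c = 0" "poly s c \<noteq> 0"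
  shows "order c r = Suc (order c (wronskian r s))"
proof -
  define X where "X = [:-c, 1:]"
  define e where "e = order c r"
  obtain u where u: "r = X ^ e * u" "\<not> X dvd u"
    using order_decomp[OF assms(1)] unfolding e_def X_def by blast
  have "e \<noteq> 0" using assms order_root[of r c] by (simp add: e_def)
  then obtain k where k: "e = Suc k" by (cases e) auto
  have uc: "poly u c \<noteq> 0" using u(2) by (simp add: X_def poly_eq_0_iff_dvd)
  have X: "pderiv X = 1" by (simp add: X_def pderiv_pCons)
  define v where "v = of_nat (Suc k) * u * s + X * (pderiv u * s - u * pderiv s)"
  have "pderiv r = X ^ Suc k * pderiv u + of_nat (Suc k) * X ^ k * u"
    unfolding u(1) k pderiv_mult pderiv_power_Suc X
    by (simp add: of_nat_poly mult.commute del: of_nat_Suc)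
  then have W: "wronskian r s = X ^ k * v"
    unfolding wronskian_def v_def u(1) k by (simp add: algebra_simps del: of_nat_Suc)
  have "poly v c = of_nat (Suc k) * poly u c * poly s c"
    by (simp add: v_def X_def of_nat_poly del: of_nat_Suc)
  then have "poly v c \<noteq> 0" using uc assms(3) by (simp del: of_nat_Suc)
  then have v: "\<not> X dvd v" by (simp add: X_def poly_eq_0_iff_dvd)
  have "order c (wronskian r s) = k"
  proof (rule order_unique_lemma)
    show "[:-c, 1:] ^ k dvd wronskian r s" unfolding W X_def by simp
    have "X ^ k \<noteq> 0" by (simp add: X_def)
    then show "\<not> [:-c, 1:] ^ Suc k dvd wronskian r s"
      unfolding W power_Suc2 X_def[symmetric] using v by simp
  qed
  then show ?thesis using k e_def by simp
qed

text \<open>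
  The counterpart at infinity of the previous lemma: the top coefficients of the two products do not
  cancel because the degrees of \<open>r\<close> and \<open>s\<close> differ.
\<close>

lemma degree_wronskian:
  assumes "r \<noteq> 0" "degree r < degree s"
  shows "degree (wronskian r s) = degree s + degree r - 1"
proof (cases "degree r = 0")
  case True
  then obtain k where k: "r = [:k:]" using degree_eq_zeroE by blast
  then have "k \<noteq> 0" using assms by simp
  then show ?thesis using True k by (simp add: wronskian_def degree_pderiv)
next
  case False
  let ?N = "degree s + degree r - 1"
  have N: "?N = degree (pderiv r) + degree s" "?N = degree r + degree (pderiv s)"
    using False assms by (simp_all add: degree_pderiv)
  have "coeff (pderiv r * s) ?N = of_nat (degree r) * lead_coeff r * lead_coeff s"
    unfolding N(1) coeff_mult_degree_sum using False by (simp add: degree_pderiv coeff_pderiv)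
  moreover have "coeff (r * pderiv s) ?N = lead_coeff r * (of_nat (degree s) * lead_coeff s)"
    unfolding N(2) coeff_mult_degree_sum using False assms by (simp add: degree_pderiv coeff_pderiv)
  ultimately have "coeff (wronskian r s) ?N
      = (of_nat (degree r) - of_nat (degree s)) * (lead_coeff r * lead_coeff s)"
    by (simp add: wronskian_def algebra_simps)
  moreover have "(of_nat (degree r) :: complex) - of_nat (degree s) \<noteq> 0"
    using assms by simp
  ultimately have "coeff (wronskian r s) ?N \<noteq> 0" using assms by auto
  moreover have "degree (pderiv r * s) \<le> ?N" unfolding N(1) by (rule degree_mult_le)
  moreover have "degree (r * pderiv s) \<le> ?N" unfolding N(2) by (rule degree_mult_le)
  moreover have "degree (wronskian r s) \<le> ?N"
    unfolding wronskian_def by (rule degree_diff_le) fact+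
  ultimately show ?thesis using le_degree by (metis antisym)
qed

text \<open>
  Replacing one of \<open>p\<close>, \<open>q\<close> by a linear combination changes the Wronskian by a constant factor only,
  which allows to choose the combination that vanishes at a given point.
\<close>

lemma wronskian_pencil:
  "wronskian (smult u p + smult v q) q = smult u (wronskian p q)"
  "wronskian (smult u p + smult v q) p = smult (- v) (wronskian p q)"
  by (simp_all add: wronskian_def pderiv_add pderiv_smult algebra_simps smult_diff_right)

lemma degree_eq_sum_order:
  fixes p :: "complex poly"
  assumes "p \<noteq> 0"
  shows "degree p = (\<Sum>z | poly p z = 0. order z p)"
proof -
  have "degree p = degree (smult (lead_coeff p) (\<Prod>z | poly p z = 0. [:-z, 1:] ^ order z p))"
    using complex_poly_decompose[of p] by simp
  also have "\<dots> = degree (\<Prod>z | poly p z = 0. [:-z, 1:] ^ order z p)"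
    using assms by simp
  also have "\<dots> = (\<Sum>z | poly p z = 0. degree ([:-z, 1:] ^ order z p))"
    by (rule degree_prod_eq_sum_degree) auto
  finally show ?thesis by (simp add: degree_power_eq)
qed

section \<open>Critical points of rational maps\<close>

text \<open>
  The chart around the value is \<open>p / q\<close> or \<open>q / p\<close>, and up to sign these have
  the same numerator of the derivative. Division by zero returns zero, which agrees with the values
  that \<open>chart\<close> assigns outside its domain, so the two formulas hold for all \<open>t\<close>.
\<close>

lemma chart_derivative_zero_iff:
  fixes p q :: "complex poly"
  assumes "poly p z \<noteq> 0 \<or> poly q z \<noteq> 0"
  shows "((\<lambda>t. chart (hom_point (poly p z) (poly q z)) (hom_point (poly p t) (poly q t)))
           has_field_derivative 0) (at z) \<longleftrightarrow> poly (wronskian p q) z = 0"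
proof (cases "poly q z = 0")
  case False
  have e: "chart (hom_point (poly p z) (poly q z)) (hom_point (poly p t) (poly q t)) = poly p t / poly q t" for t
    using False by (simp add: chart_def hom_point_def)
  have D: "((\<lambda>t. poly p t / poly q t) has_field_derivative
      (poly (pderiv p) z * poly q z - poly p z * poly (pderiv q) z) / (poly q z * poly q z)) (at z)"
    by (intro DERIV_divide poly_DERIV False)
  show ?thesis unfolding e
  proof
    assume "((\<lambda>t. poly p t / poly q t) has_field_derivative 0) (at z)"
    from DERIV_unique[OF this D] show "poly (wronskian p q) z = 0"
      using False by (simp add: wronskian_def)
  next
    assume "poly (wronskian p q) z = 0"
    then show "((\<lambda>t. poly p t / poly q t) has_field_derivative 0) (at z)"
      using D by (simp add: wronskian_def)
  qed
next
  case True
  then have nz: "poly p z \<noteq> 0" using assms by simp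
  have e: "chart (hom_point (poly p z) (poly q z)) (hom_point (poly p t) (poly q t)) = poly q t / poly p t" for t
    using True by (simp add: chart_def hom_point_def)
  have D: "((\<lambda>t. poly q t / poly p t) has_field_derivative
      (poly (pderiv q) z * poly p z - poly q z * poly (pderiv p) z) / (poly p z * poly p z)) (at z)"
    by (intro DERIV_divide poly_DERIV nz)
  show ?thesis unfolding e
  proof
    assume "((\<lambda>t. poly q t / poly p t) has_field_derivative 0) (at z)"
    from DERIV_unique[OF this D] show "poly (wronskian p q) z = 0"
      using nz by (simp add: wronskian_def True)
  next
    assume "poly (wronskian p q) z = 0"
    then have "poly (pderiv q) z * poly p z - poly q z * poly (pderiv p) z = 0"
      by (simp add: wronskian_def algebra_simps)
    then show "((\<lambda>t. poly q t / poly p t) has_field_derivative 0) (at z)"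
      using D by simp
  qed
qed

lemma coprime_poly_nonzero:
  assumes "coprime p (q :: complex poly)"
  shows "poly p z \<noteq> 0 \<or> poly q z \<noteq> 0"
proof (rule ccontr)
  assume "\<not> ?thesis"
  then have "[:-z, 1:] dvd p" "[:-z, 1:] dvd q" by (simp_all add: poly_eq_0_iff_dvd)
  then have "is_unit [:-z, 1:]" using assms coprime_common_divisor by blast
  then show False by (simp add: is_unit_iff_degree)
qed

lemma Some_critical_iff:
  assumes "coprime p q"
  shows "Some z \<in> critical_points (rat_fun p q) \<longleftrightarrow> poly (wronskian p q) z = 0"
proof -
  have "chart (rat_fun p q (Some z)) \<circ> rat_fun p q \<circ> chart_inv (Some z) =
    (\<lambda>t. chart (hom_point (poly p z) (poly q z)) (hom_point (poly p t) (poly q t)))"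
    by (simp add: fun_eq_iff rat_fun_def chart_inv_def)
  moreover have "chart (Some z) (Some z) = z" by (simp add: chart_def)
  ultimately show ?thesis
    using chart_derivative_zero_iff[OF coprime_poly_nonzero[OF assms, of z]]
    by (simp add: critical_points_def)
qed

text \<open>
  The polynomial \<open>t ^ n * p (1 / t)\<close>, for \<open>n \<ge> degree p\<close>.
\<close>

definition reversed :: "nat \<Rightarrow> complex poly \<Rightarrow> complex poly" where
  "reversed n p = (\<Sum>i\<le>n. monom (coeff p (n - i)) i)"

lemma coeff_reversed: "i \<le> n \<Longrightarrow> coeff (reversed n p) i = coeff p (n - i)"
  by (simp add: reversed_def coeff_sum)

lemma poly_reversed:
  assumes "degree p \<le> n" "t \<noteq> 0"
  shows "poly (reversed n p) t = t ^ n * poly p (1 / t)"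
proof -
  have "poly p (1 / t) = poly (\<Sum>i\<le>n. monom (coeff p i) i) (1 / t)"
    using poly_as_sum_of_monoms'[OF assms(1)] by simp
  also have "\<dots> = (\<Sum>i\<le>n. coeff p i * (1 / t) ^ i)" by (simp add: poly_sum poly_monom)
  finally have "t ^ n * poly p (1 / t) = (\<Sum>i\<le>n. t ^ n * (coeff p i * (1 / t) ^ i))"
    by (simp add: sum_distrib_left)
  also have "\<dots> = (\<Sum>i\<le>n. coeff p (n - i) * t ^ i)"
  proof (rule sum.reindex_bij_witness[of _ "\<lambda>i. n - i" "\<lambda>i. n - i"])
    fix i assume "i \<in> {..n}"
    then show "coeff p (n - (n - i)) * t ^ (n - i) = t ^ n * (coeff p i * (1 / t) ^ i)"
      using assms(2) by (simp add: power_diff power_divide)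
  qed auto
  finally show ?thesis by (simp add: reversed_def poly_sum poly_monom)
qed

text \<open>
  In the coordinate \<open>1 / z\<close> the map is given by the reversed polynomials, and the right-hand side is
  their Wronskian at \<open>0\<close>.
\<close>

lemma None_critical_iff:
  assumes "coprime p q" "n = max (degree p) (degree q)" "n \<ge> 1"
  shows "None \<in> critical_points (rat_fun p q) \<longleftrightarrow>
    coeff p (n - 1) * coeff q n - coeff p n * coeff q (n - 1) = 0"
proof -
  let ?P = "reversed n p" and ?Q = "reversed n q"
  have P0: "poly ?P 0 = coeff p n" "poly ?Q 0 = coeff q n"
    by (simp_all add: poly_0_coeff_0 coeff_reversed)
  have P1: "poly (pderiv ?P) 0 = coeff p (n - 1)" "poly (pderiv ?Q) 0 = coeff q (n - 1)"
    using assms(3) by (simp_all add: poly_0_coeff_0 coeff_pderiv coeff_reversed)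
  have val: "rat_fun p q (hom_point 1 t) = hom_point (poly ?P t) (poly ?Q t)" for t
  proof (cases "t = 0")
    case True
    then show ?thesis using P0 assms(2) by (simp add: hom_point_def[of 1] rat_fun_def Let_def)
  next
    case False
    then have "hom_point (poly ?P t) (poly ?Q t) = hom_point (poly p (1 / t)) (poly q (1 / t))"
      using assms(2) by (simp add: poly_reversed hom_point_scale)
    then show ?thesis using False by (simp add: hom_point_def[of 1] rat_fun_def)
  qed
  have "rat_fun p q None = hom_point (poly ?P 0) (poly ?Q 0)" using val[of 0] by (simp add: hom_point_def[of 1])
  then have "chart (rat_fun p q None) \<circ> rat_fun p q \<circ> chart_inv None =
    (\<lambda>t. chart (hom_point (poly ?P 0) (poly ?Q 0)) (hom_point (poly ?P t) (poly ?Q t)))"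
    by (simp add: fun_eq_iff chart_inv_def val)
  moreover have "chart None None = 0" by (simp add: chart_def)
  moreover have "poly ?P 0 \<noteq> 0 \<or> poly ?Q 0 \<noteq> 0"
  proof -
    have "coeff p n \<noteq> 0 \<or> coeff q n \<noteq> 0"
      using assms(2,3) by (cases "degree p \<le> degree q") (auto simp: max_def)
    then show ?thesis using P0 by simp
  qed
  ultimately have "None \<in> critical_points (rat_fun p q) \<longleftrightarrow> poly (wronskian ?P ?Q) 0 = 0"
    using chart_derivative_zero_iff[of ?P 0 ?Q] by (simp add: critical_points_def)
  then show ?thesis by (simp add: wronskian_def P0 P1)
qed

section \<open>Normal form of bicritical maps\<close>

lemma coeff_linear_power_top: "degree ([:b, a:] ^ n) \<le> n \<and> coeff ([:b, a:] ^ n) n = (a::complex) ^ n"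
proof (induction n)
  case (Suc n)
  have "degree ([:b, a:] ^ Suc n) \<le> degree [:b, a:] + degree ([:b, a:] ^ n)"
    unfolding power_Suc by (rule degree_mult_le)
  also have "\<dots> \<le> Suc n" using Suc by auto
  finally have 1: "degree ([:b, a:] ^ Suc n) \<le> Suc n" .
  have "coeff ([:b, a:] ^ n) (Suc n) = 0" using Suc by (intro coeff_eq_0) simp
  then have "coeff ([:b, a:] ^ Suc n) (Suc n) = a ^ Suc n" using Suc by simp
  with 1 show ?case by blast
qed simp

lemma power_map_hom_point:
  assumes "n \<ge> 1"
  shows "power_map n (hom_point x y) = hom_point (x ^ n) (y ^ n)"
  using assms by (simp add: power_map_def hom_point_def power_divide)

text \<open>
  If two independent combinations of \<open>p\<close> and \<open>q\<close> are \<open>n\<close>-th powers of linear forms, then after a change of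
  coordinates in the target the map raises a Moebius transformation to the power \<open>n\<close>. A
  linear form whose leading coefficient is \<open>0\<close> vanishes at infinity.
\<close>

lemma rat_fun_eq_power_map:
  assumes pq: "coprime p q" "n = max (degree p) (degree q)" "n \<ge> 1"
    and det: "u1 * v2 - v1 * u2 \<noteq> 0" "a * d - b * c \<noteq> 0"
    and nz: "k1 \<noteq> 0" "k2 \<noteq> 0"
    and r1: "smult u1 p + smult v1 q = smult k1 ([:b, a:] ^ n)"
    and r2: "smult u2 p + smult v2 q = smult k2 ([:d, c:] ^ n)"
  shows "\<exists>M. moebius_transformation M \<and> rat_fun p q = M \<circ> power_map n \<circ> moebius a b c d"
proof -
  let ?A = "moebius u1 v1 u2 v2" and ?D = "moebius k1 0 0 k2"
  have ev1: "u1 * poly p z + v1 * poly q z = k1 * (b + z * a) ^ n" for z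
    using arg_cong[OF r1, of "\<lambda>r. poly r z"] by (simp add: poly_power)
  have ev2: "u2 * poly p z + v2 * poly q z = k2 * (d + z * c) ^ n" for z
    using arg_cong[OF r2, of "\<lambda>r. poly r z"] by (simp add: poly_power)
  have top1: "u1 * coeff p n + v1 * coeff q n = k1 * a ^ n"
    using arg_cong[OF r1, of "\<lambda>r. coeff r n"] by (simp add: coeff_linear_power_top)
  have top2: "u2 * coeff p n + v2 * coeff q n = k2 * c ^ n"
    using arg_cong[OF r2, of "\<lambda>r. coeff r n"] by (simp add: coeff_linear_power_top)
  have eq: "?A (rat_fun p q x) = ?D (power_map n (moebius a b c d x))" for x
  proof (cases x)
    case None
    have "coeff p n \<noteq> 0 \<or> coeff q n \<noteq> 0"
      using pq(2,3) by (cases "degree p \<le> degree q") (auto simp: max_def)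
    moreover have "rat_fun p q x = hom_point (coeff p n) (coeff q n)"
      unfolding None pq(2) by (simp add: rat_fun_def Let_def)
    ultimately have "?A (rat_fun p q x) = hom_point (k1 * a ^ n) (k2 * c ^ n)"
      by (simp add: moebius_hom_point top1 top2)
    moreover have "a \<noteq> 0 \<or> c \<noteq> 0" using det by auto
    ultimately show ?thesis using None pq(3)
      by (simp add: moebius_def[of a] power_map_hom_point moebius_hom_point)
  next
    case (Some z)
    have "?A (rat_fun p q x) = hom_point (k1 * (b + z * a) ^ n) (k2 * (d + z * c) ^ n)"
      using Some coprime_poly_nonzero[OF pq(1), of z] by (simp add: rat_fun_def moebius_hom_point ev1 ev2)
    moreover have "a * z + b \<noteq> 0 \<or> c * z + d \<noteq> 0"
      using nonsingular_nonzero[OF det(2), of z 1] by simp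
    ultimately show ?thesis using Some pq(3)
      by (simp add: moebius_def[of a] power_map_hom_point moebius_hom_point algebra_simps)
  qed
  have "moebius_transformation ?A" using det(1) unfolding moebius_transformation_def by blast
  then obtain N where N: "moebius_transformation N" "N \<circ> ?A = id" "?A \<circ> N = id"
    by (rule moebius_transformation_inverse)
  have "k1 * k2 - 0 * 0 \<noteq> 0" using nz by simp
  then have "moebius_transformation ?D" unfolding moebius_transformation_def by blast
  then have "moebius_transformation (N \<circ> ?D)" by (rule moebius_transformation_comp[OF N(1)])
  moreover have "rat_fun p q = N \<circ> ?D \<circ> power_map n \<circ> moebius a b c d"
  proof
    fix x
    have "rat_fun p q x = N (?A (rat_fun p q x))" using N(2) by (simp add: fun_eq_iff)
    then show "rat_fun p q x = (N \<circ> ?D \<circ> power_map n \<circ> moebius a b c d) x" by (simp add: eq)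
  qed
  ultimately show ?thesis by blast
qed

text \<open>
  The combination \<open>r\<close> vanishes at \<open>c\<close>, to one order more than the Wronskian does. Since its degree is at most
  \<open>n\<close>, the order of the Wronskian is at most \<open>n - 1\<close>, and in the case of equality \<open>r\<close> has no other
  roots.
\<close>

lemma pencil_at_point:
  fixes p q :: "complex poly" and c :: complex
  assumes "coprime p q" "wronskian p q \<noteq> 0" "n = max (degree p) (degree q)"
  defines "r \<equiv> smult (poly q c) p + smult (- poly p c) q"
  shows "Suc (order c (wronskian p q)) \<le> n"
    and "Suc (order c (wronskian p q)) = n \<Longrightarrow> \<exists>k. k \<noteq> 0 \<and> r = smult k ([:-c, 1:] ^ n)"
proof -
  obtain s k where s: "poly s c \<noteq> 0" "k \<noteq> 0" "wronskian r s = smult k (wronskian p q)"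
  proof (cases "poly q c = 0")
    case False
    then show ?thesis using that[of q "poly q c"] unfolding r_def wronskian_pencil(1) by simp
  next
    case True
    then have "poly p c \<noteq> 0" using coprime_poly_nonzero[OF assms(1)] by blast
    then show ?thesis using that[of p "poly p c"] unfolding r_def wronskian_pencil(2) by simp
  qed
  have r: "r \<noteq> 0"
  proof
    assume "r = 0"
    then have "wronskian r s = 0" by (simp add: wronskian_def)
    then show False using s assms(2) by simp
  qed
  have "poly r c = 0" by (simp add: r_def)
  then have ord: "order c r = Suc (order c (wronskian p q))"
    using order_wronskian[OF r _ s(1)] s by (simp add: order_smult)
  have deg: "degree r \<le> n" unfolding r_def assms(3)
    by (intro degree_add_le) (meson degree_smult_le le_trans max.cobounded1 max.cobounded2)+
  show "Suc (order c (wronskian p q)) \<le> n"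
    using order_degree[OF r, of c] deg ord by linarith
  assume n: "Suc (order c (wronskian p q)) = n"
  obtain u where u: "r = [:-c, 1:] ^ n * u"
    using order_decomp[OF r, of c] unfolding ord n by blast
  then have "u \<noteq> 0" using r by auto
  then have "degree r = n + degree u"
    unfolding u by (subst degree_mult_eq) (auto simp: degree_power_eq)
  then have "degree u = 0" using deg by simp
  then obtain k where "u = [:k:]" using degree_eq_zeroE by blast
  then show "\<exists>k. k \<noteq> 0 \<and> r = smult k ([:-c, 1:] ^ n)" using u \<open>u \<noteq> 0\<close> by (auto simp: mult.commute)
qed

text \<open>
  Here the combination \<open>r\<close> vanishes at infinity, that is, its degree drops below \<open>n\<close>.
\<close>

lemma pencil_at_infinity:
  assumes "wronskian p q \<noteq> 0" "n = max (degree p) (degree q)" "n \<ge> 1"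
  defines "r \<equiv> smult (coeff q n) p + smult (- coeff p n) q"
  shows "r \<noteq> 0" "degree r < n" "degree (wronskian p q) = n + degree r - 1"
proof -
  have top: "coeff p n \<noteq> 0 \<or> coeff q n \<noteq> 0"
    using assms(2,3) by (cases "degree p \<le> degree q") (auto simp: max_def)
  obtain s k where s: "degree s = n" "k \<noteq> 0" "wronskian r s = smult k (wronskian p q)"
  proof (cases "coeff q n = 0")
    case False
    then have "degree q = n" using assms(2) le_degree[OF False] by simp
    then show ?thesis using that[of q "coeff q n"] False unfolding r_def wronskian_pencil(1) by simp
  next
    case True
    then have "coeff p n \<noteq> 0" using top by blast
    then have "degree p = n" using assms(2) le_degree[of p n] by simp
    then show ?thesis using that[of p "coeff p n"] \<open>coeff p n \<noteq> 0\<close> unfolding r_def wronskian_pencil(2) by simp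
  qed
  show r: "r \<noteq> 0"
  proof
    assume "r = 0"
    then have "wronskian r s = 0" by (simp add: wronskian_def)
    then show False using s assms(1) by simp
  qed
  have "degree r \<le> n" unfolding r_def assms(2)
    by (intro degree_add_le) (meson degree_smult_le le_trans max.cobounded1 max.cobounded2)+
  moreover have "coeff r n = 0" by (simp add: r_def)
  ultimately show lt: "degree r < n" using r leading_coeff_0_iff le_neq_implies_less by metis
  then show "degree (wronskian p q) = n + degree r - 1"
    using degree_wronskian[OF r, of s] s by simp
qed

text \<open>
  With multiplicities, a map of degree \<open>n\<close> has \<open>2 n - 2\<close> critical points, and each has
  multiplicity at most \<open>n - 1\<close>. Two critical points therefore both have multiplicity
  \<open>n - 1\<close>, so that the combinations of \<open>p\<close> and \<open>q\<close> that vanish there are \<open>n\<close>-th powers of linear forms.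
\<close>

lemma bicritical_normal_form:
  assumes "rational_map f" "bicritical f"
  obtains M B d where "d \<ge> 2" "moebius_transformation M" "moebius_transformation B"
    "f = M \<circ> power_map d \<circ> B" "critical_points f = {x. B x \<in> {Some 0, None}}"
proof -
  obtain p q where pq: "coprime p q" "f = rat_fun p q"
    using assms(1) unfolding rational_map_def by blast
  define n where "n = max (degree p) (degree q)"
  define W where "W = wronskian p q"
  have card: "card (critical_points f) = 2" using assms(2) by (simp add: bicritical_def)
  have Some_crit: "Some z \<in> critical_points f \<longleftrightarrow> poly W z = 0" for z
    unfolding pq(2) W_def by (rule Some_critical_iff[OF pq(1)])
  have fin: "finite (critical_points f)" using card by (intro card_ge_0_finite) simp
  have W: "W \<noteq> 0"
  proof
    assume "W = 0"
    then have "range Some \<subseteq> critical_points f" using Some_crit by auto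
    then have "finite (range (Some :: complex \<Rightarrow> _))" using fin finite_subset by blast
    then have "finite (UNIV :: complex set)" by (rule finite_imageD) simp
    then show False using infinite_UNIV_char_0 by blast
  qed
  have n: "n \<ge> 1"
  proof (rule ccontr)
    assume "\<not> ?thesis"
    then have "degree p = 0" "degree q = 0" by (simp_all add: n_def)
    then have "W = 0" by (auto simp: W_def wronskian_def elim!: degree_eq_zeroE simp: pderiv_pCons)
    then show False using W by simp
  qed
  define rc where "rc c = smult (poly q c) p + smult (- poly p c) q" for c
  define ri where "ri = smult (coeff q n) p + smult (- coeff p n) q"
  note at_inf = pencil_at_infinity[OF W[unfolded W_def] n_def n, folded W_def ri_def]
  note at_pt = pencil_at_point[OF pq(1) W[unfolded W_def] n_def, folded W_def rc_def]
  have deg: "degree W = (\<Sum>z | poly W z = 0. order z W)" by (rule degree_eq_sum_order[OF W])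
  have n2: "n \<ge> 2" if "poly W c = 0" "Suc (order c W) = n" for c
    using that W order_root[of W c] by simp
  obtain x y where xy: "critical_points f = {x, y}" "x \<noteq> y" using card by (auto simp: card_2_iff)
  have "\<exists>c1 b. critical_points f = {Some c1, b} \<and> b \<noteq> Some c1"
  proof (cases x)
    case None
    then show ?thesis using xy by (cases y) auto
  qed (use xy in auto)
  then obtain c1 b where cb: "critical_points f = {Some c1, b}" "b \<noteq> Some c1" by blast
  have c1: "poly W c1 = 0" using Some_crit[of c1] cb by simp
  show ?thesis
  proof (cases b)
    case None
    have "{z. poly W z = 0} = {c1}" using Some_crit cb None by auto
    \<comment> \<open>The only root of \<open>W\<close> is \<open>c1\<close>, of order at most \<open>n - 1\<close>; so \<open>ri\<close> must be constant.\<close>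
    then have "n + degree ri - 1 = order c1 W" using deg at_inf(3) by simp
    then have o: "Suc (order c1 W) = n" "degree ri = 0"
      using at_pt(1)[of c1] n by linarith+
    obtain k1 where k1: "k1 \<noteq> 0" "rc c1 = smult k1 ([:-c1, 1:] ^ n)" using at_pt(2)[OF o(1)] by blast
    obtain k2 where k2: "ri = [:k2:]" using o(2) degree_eq_zeroE by blast
    have "k2 \<noteq> 0" using at_inf(1) k2 by simp
    have "poly ri c1 = k2" using k2 by simp
    then have det: "poly q c1 * (- coeff p n) - (- poly p c1) * coeff q n \<noteq> 0"
      using \<open>k2 \<noteq> 0\<close> by (simp add: ri_def algebra_simps)
    have "\<exists>M. moebius_transformation M \<and> rat_fun p q = M \<circ> power_map n \<circ> moebius 1 (- c1) 0 1"
    proof (rule rat_fun_eq_power_map[OF pq(1) n_def n det _ k1(1) \<open>k2 \<noteq> 0\<close>])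
      show "smult (poly q c1) p + smult (- poly p c1) q = smult k1 ([:- c1, 1:] ^ n)"
        using k1(2) by (simp add: rc_def)
      have "[:1, 0:] ^ n = (1 :: complex poly)" by (simp flip: one_pCons)
      then show "smult (coeff q n) p + smult (- coeff p n) q = smult k2 ([:1, 0:] ^ n)"
        using k2 unfolding ri_def by simp
    qed simp
    then obtain M where "moebius_transformation M" "f = M \<circ> power_map n \<circ> moebius 1 (- c1) 0 1"
      using pq(2) by blast
    moreover have "x \<in> critical_points f \<longleftrightarrow> moebius 1 (- c1) 0 1 x \<in> {Some 0, None}" for x
      unfolding cb(1) None by (cases x) (auto simp: moebius_def hom_point_def)
    then have "critical_points f = {x. moebius 1 (- c1) 0 1 x \<in> {Some 0, None}}" by blast
    ultimately show ?thesis using that n2[OF c1 o(1)] moebius_transformation_shift by blast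
  next
    case (Some c2)
    have c2: "c2 \<noteq> c1" "poly W c2 = 0" using cb Some Some_crit[of c2] by auto
    have "None \<notin> critical_points f" using cb Some by simp
    then have "coeff p (n - 1) * coeff q n - coeff p n * coeff q (n - 1) \<noteq> 0"
      using None_critical_iff[OF pq(1) n_def n] pq(2) by simp
    then have "coeff ri (n - 1) \<noteq> 0" by (simp add: ri_def algebra_simps)
    then have "degree ri \<ge> n - 1" by (rule le_degree)
    \<comment> \<open>As infinity is not critical, the degree of \<open>ri\<close> is as large as possible.\<close>
    then have "degree W = 2 * (n - 1)" using at_inf(2,3) n by linarith
    moreover have "{z. poly W z = 0} = {c1, c2}" using Some_crit cb Some by auto
    ultimately have "order c1 W + order c2 W = 2 * (n - 1)"
      using deg c2 by simp
    then have o: "Suc (order c1 W) = n" "Suc (order c2 W) = n"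
      using at_pt(1)[of c1] at_pt(1)[of c2] by linarith+
    obtain k1 where k1: "k1 \<noteq> 0" "rc c1 = smult k1 ([:-c1, 1:] ^ n)" using at_pt(2)[OF o(1)] by blast
    obtain k2 where k2: "k2 \<noteq> 0" "rc c2 = smult k2 ([:-c2, 1:] ^ n)" using at_pt(2)[OF o(2)] by blast
    have "poly (rc c2) c1 \<noteq> 0" unfolding k2(2) using k2(1) c2 by (simp add: poly_power)
    then have det: "poly q c1 * (- poly p c2) - (- poly p c1) * poly q c2 \<noteq> 0"
      by (simp add: rc_def algebra_simps)
    have B: "1 * (- c2) - (- c1) * 1 \<noteq> 0" using c2 by simp
    have "\<exists>M. moebius_transformation M \<and> rat_fun p q = M \<circ> power_map n \<circ> moebius 1 (- c1) 1 (- c2)"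
      using rat_fun_eq_power_map[OF pq(1) n_def n det B k1(1) k2(1)] k1(2) k2(2) by (simp add: rc_def)
    then obtain M where "moebius_transformation M" "f = M \<circ> power_map n \<circ> moebius 1 (- c1) 1 (- c2)"
      using pq(2) by blast
    moreover have "x \<in> critical_points f \<longleftrightarrow> moebius 1 (- c1) 1 (- c2) x \<in> {Some 0, None}" for x
      unfolding cb(1) Some using c2(1) by (cases x) (auto simp: moebius_def hom_point_def)
    then have "critical_points f = {x. moebius 1 (- c1) 1 (- c2) x \<in> {Some 0, None}}" by blast
    moreover have "moebius_transformation (moebius 1 (- c1) 1 (- c2))"
      using B unfolding moebius_transformation_def by blast
    ultimately show ?thesis using that n2[OF c1 o(1)] by blast
  qed
qed

section \<open>Deck transformations and critical points of bicritical maps\<close>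

theorem theorem1p2:
  fixes f \<phi> :: "riemann_sphere \<Rightarrow> riemann_sphere" and k :: nat
  assumes "rational_map f"
    and "bicritical f"
    and "k \<ge> 1"
    and "\<phi> \<in> Deck (f ^^ k)"
  shows "\<phi> ` critical_points f = critical_points f"
proof -
  obtain M B d where nf: "d \<ge> 2" "moebius_transformation M" "moebius_transformation B"
    "f = M \<circ> power_map d \<circ> B" "critical_points f = {x. B x \<in> {Some 0, None}}"
    using bicritical_normal_form[OF assms(1,2)] .
  obtain B' where B': "moebius_transformation B'" "B' \<circ> B = id" "B \<circ> B' = id"
    using moebius_transformation_inverse[OF nf(3)] .
  interpret N: power_moebius_map "B \<circ> M" d
    using nf by unfold_locales (auto intro: moebius_transformation_comp)
  let ?g = N.f
  have g: "?g = B \<circ> M \<circ> power_map d" by (rule N.f_def)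
  \<comment> \<open>The conjugate of \<open>f\<close> by \<open>B\<close> has its critical points at \<open>0\<close> and infinity.\<close>
  have "B \<circ> f = ?g \<circ> B" unfolding nf(4) g by (simp add: comp_assoc)
  then have fg: "?g ^^ k \<circ> B = B \<circ> f ^^ k" by (intro funpow_semiconj) simp
  have phi: "moebius_transformation \<phi>" "f ^^ k \<circ> \<phi> = f ^^ k" using assms(4) by (auto simp: Deck_def)
  have "?g ^^ k \<circ> (B \<circ> \<phi> \<circ> B') = B \<circ> (f ^^ k \<circ> \<phi>) \<circ> B'"
    using fg by (metis comp_assoc)
  also have "\<dots> = ?g ^^ k \<circ> (B \<circ> B')" unfolding phi(2) using fg by (metis comp_assoc)
  finally have "?g ^^ k \<circ> (B \<circ> \<phi> \<circ> B') = ?g ^^ k" using B' by simp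
  then have "B \<circ> \<phi> \<circ> B' \<in> Deck (?g ^^ k)"
    using phi nf(3) B'(1) by (auto simp: Deck_def intro: moebius_transformation_comp)
  then have im: "(B \<circ> \<phi> \<circ> B') ` N.C = N.C" by (rule N.Deck_preserves_C)
  have crit: "critical_points f = B' ` N.C"
  proof -
    have inv: "B' (B x) = x" "B (B' x) = x" for x using B'(2,3) by (simp_all add: fun_eq_iff)
    have "{x. B x \<in> N.C} = B' ` N.C"
    proof (intro Set.set_eqI iffI)
      fix x assume "x \<in> {x. B x \<in> N.C}"
      then have "B' (B x) \<in> B' ` N.C" by blast
      then show "x \<in> B' ` N.C" by (simp add: inv)
    qed (auto simp: inv)
    then show ?thesis using nf(5) by (simp add: N.C_def)
  qed
  have "\<phi> ` B' ` N.C = (B' \<circ> B) ` \<phi> ` B' ` N.C" using B' by simp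
  also have "\<dots> = B' ` (B \<circ> \<phi> \<circ> B') ` N.C" by (simp add: image_comp comp_assoc)
  also have "\<dots> = B' ` N.C" unfolding im ..
  finally show ?thesis unfolding crit .
qed

end
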